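(* Let $Z\sim\mathcal{W}_2(2,\tfrac12 I_2)$ and let $X=(X_1,X_2,X_3)^\top$ with $X_j=\mathrm{Tr}(H_jZ)$, $j=1,2,3$, where $$H_1=\begin{pmatrix}1&0\\0&1\end{pmatrix},\quad H_2=\begin{pmatrix}2&1\\1&2\end{pmatrix},\quad H_3=\begin{pmatrix}3&0\\0&1\end{pmatrix}.$$ Then the distribution of $X$ admits no finite-dimensional ${}_3\mathrm{MPH}^{*}$ representation, i.e. $X\notin{}_3\mathrm{MPH}^{*}$.
   Context: $\mathcal{W}_2(2,\tfrac12 I_2)$ is the Wishart distribution on $2\times2$ symmetric positive semidefinite matrices with $2$ degrees of freedom and scale matrix $\tfrac12I_2$: $Z=\tfrac12(G_1G_1^\top+G_2G_2^\top)$ with $G_1,G_2$ independent standard Gaussian column vectors in $\mathbb{R}^2$. Equivalently, $Z$ has density $f_Z(z)=\pi^{-1}\det(z)^{-1/2}e^{-\mathrm{Tr}(z)}$ on positive definite $z=\begin{pmatrix} z_{11} & z_{12} \\ z_{12} & z_{22} \end{pmatrix}$ with respect to Lebesgue measure in $(z_{11},z_{22},z_{12})$; its transform is $\mathbb{E}[e^{-\mathrm{Tr}(BZ)}]=\det(I_2+B)^{-1}$ for every symmetric positive semidefinite $B$. Let $\mathbb{R}_+^n=[0,\infty)^n$, $\langle s,x\rangle=\sum_j s_jx_j$, $\mathbf 1$ the all-ones column vector, $\Delta(v)$ the diagonal matrix with diagonal $v$. A transient subgenerator is a matrix $T\in\mathbb{R}^{m\times m}$ with $T_{ii}<0$, $T_{ij}\ge0$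 for $i\ne j$, $T\mathbf 1\le0$ componentwise, and such that the associated continuous-time Markov chain is transient, i.e. absorption is almost sure from every state (equivalently, $T$ is invertible). The class ${}_n\mathrm{MPH}^{*}$ consists of random vectors $Y$ in $\mathbb{R}_+^n$ for which there exist $m\ge1$, a row vector $\alpha\in\mathbb{R}_+^{1\times m}$ with $\alpha\mathbf 1\le1$, a transient subgenerator $T\in\mathbb{R}^{m\times m}$, and an entrywise non-negative matrix $K\in\mathbb{R}_+^{m\times n}$ such that $\mathbb{E}[e^{-\langle s,Y\rangle}]=p_0+\alpha(-T+\Delta(Ks))^{-1}\mathbf t$, where $\mathbf t=-T\mathbf 1$ and $p_0=1-\alpha\mathbf 1$. *)

theory Defs
  imports "HOL-Probability.Probability" "Jordan_Normal_Form.Gauss_Jordan_Elimination"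
    "Jordan_Normal_Form.Determinant"
begin

text \<open>
  Matrices and vectors of a fixed size use the types of HOL-Analysis.  The order \<open>m\<close> of a
  phase-type representation is existentially quantified, so the matrices and vectors indexed by
  the phases use the carrier-based types of Jordan_Normal_Form.
\<close>

no_notation vec_index (infixl \<open>$\<close> 100)
no_notation scalar_prod (infix \<open>\<bullet>\<close> 70)

subsection \<open>Wishart distribution\<close>

definition std_gaussian :: "(real ^ 'p) measure" where
  "std_gaussian = density lborel (\<lambda>x. ennreal (\<Prod>i\<in>UNIV. std_normal_density (x $ i)))"

definition outer :: "real ^ 'p \<Rightarrow> real ^ 'p \<Rightarrow> real ^ 'p ^ 'p" where
  "outer x y = (\<chi> i j. x $ i * y $ j)"

text \<open>
  The Wishart distribution with \<open>n\<close> degrees of freedom and scale matrix \<open>c I\<close>, that is, the law of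
  \<open>c (G\<^sub>1 G\<^sub>1\<^sup>T + \<dots> + G\<^sub>n G\<^sub>n\<^sup>T)\<close> for independent standard Gaussian vectors \<open>G\<^sub>1, \<dots>, G\<^sub>n\<close>.
\<close>

definition wishart :: "nat \<Rightarrow> real \<Rightarrow> (real ^ 'p ^ 'p) measure" where
  "wishart n c = distr (Pi\<^sub>M {..<n} (\<lambda>_. std_gaussian)) borel
     (\<lambda>g. c *\<^sub>R (\<Sum>k<n. outer (g k) (g k)))"

subsection \<open>Transient subgenerators\<close>

definition subgenerator :: "nat \<Rightarrow> real mat \<Rightarrow> bool" where
  "subgenerator m T \<longleftrightarrow> T \<in> carrier_mat m m \<and>
     (\<forall>i<m. T $$ (i, i) < 0) \<and>
     (\<forall>i<m. \<forall>j<m. i \<noteq> j \<longrightarrow> 0 \<le> T $$ (i, j)) \<and>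
     (\<forall>i<m. (\<Sum>j<m. T $$ (i, j)) \<le> 0)"

text \<open>
  The probability that the chain started in state \<open>i\<close> is not absorbed within its first \<open>k\<close> jumps:
  from \<open>i\<close> the chain jumps to a state \<open>j \<noteq> i\<close> with probability \<open>T\<^sub>i\<^sub>j / (- T\<^sub>i\<^sub>i)\<close> and is absorbed
  with the remaining probability.
\<close>

primrec unabsorbed :: "nat \<Rightarrow> real mat \<Rightarrow> nat \<Rightarrow> nat \<Rightarrow> real" where
  "unabsorbed m T 0 i = 1"
| "unabsorbed m T (Suc k) i =
     (\<Sum>j\<in>{..<m} - {i}. T $$ (i, j) / (- T $$ (i, i)) * unabsorbed m T k j)"

definition transient_subgenerator :: "nat \<Rightarrow> real mat \<Rightarrow> bool" where
  "transient_subgenerator m T \<longleftrightarrow> subgenerator m T \<and>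
     (\<forall>i<m. (\<lambda>k. unabsorbed m T k i) \<longlonglongrightarrow> 0)"

lemma subgenerator_kernel_iff:
  fixes v :: "nat \<Rightarrow> real"
  assumes "subgenerator m T" "i < m"
  shows "(\<Sum>j<m. T $$ (i, j) * v j) = 0 \<longleftrightarrow>
    v i = (\<Sum>j\<in>{..<m} - {i}. T $$ (i, j) / (- T $$ (i, i)) * v j)"
proof -
  have neg: "T $$ (i, i) < 0" using assms by (auto simp: subgenerator_def)
  have "(\<Sum>j<m. T $$ (i, j) * v j) = T $$ (i, i) * v i + (\<Sum>j\<in>{..<m} - {i}. T $$ (i, j) * v j)"
    using assms(2) by (subst sum.remove[of _ i]) auto
  moreover have "(\<Sum>j\<in>{..<m} - {i}. T $$ (i, j) / (- T $$ (i, i)) * v j)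
      = (\<Sum>j\<in>{..<m} - {i}. T $$ (i, j) * v j) / (- T $$ (i, i))"
    by (simp add: sum_divide_distrib sum_negf)
  moreover have "a * x + S = 0 \<longleftrightarrow> x = S / (- a)" if "a < 0" for a x S :: real
    using that by (simp add: field_simps) linarith
  ultimately show ?thesis using neg by simp
qed

lemma unabsorbed_nonneg:
  assumes "subgenerator m T" "i < m"
  shows "0 \<le> unabsorbed m T k i"
  using assms(2)
proof (induction k arbitrary: i)
  case (Suc k)
  have "0 \<le> T $$ (i, j) / (- T $$ (i, i)) * unabsorbed m T k j" if "j \<in> {..<m} - {i}" for j
    using Suc that assms(1)
    by (intro mult_nonneg_nonneg divide_nonneg_pos) (auto simp: subgenerator_def)
  then show ?case by (simp only: unabsorbed.simps) (rule sum_nonneg)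
qed simp

lemma unabsorbed_Suc_le:
  assumes "subgenerator m T" "i < m"
  shows "unabsorbed m T (Suc k) i \<le> unabsorbed m T k i"
  using assms(2)
proof (induction k arbitrary: i)
  case 0
  have neg: "T $$ (i, i) < 0" and "(\<Sum>j<m. T $$ (i, j)) \<le> 0"
    using assms(1) 0 by (auto simp: subgenerator_def)
  then have "(\<Sum>j\<in>{..<m} - {i}. T $$ (i, j)) \<le> - T $$ (i, i)"
    using 0 by (subst (asm) sum.remove[of _ i]) auto
  then have "(\<Sum>j\<in>{..<m} - {i}. T $$ (i, j)) / (- T $$ (i, i)) \<le> 1"
    using neg by (subst divide_le_eq_1_pos) auto
  then show ?case by (simp add: sum_divide_distrib sum_negf)
next
  case (Suc k)
  have "T $$ (i, j) / (- T $$ (i, i)) * unabsorbed m T (Suc k) j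
      \<le> T $$ (i, j) / (- T $$ (i, i)) * unabsorbed m T k j" if "j \<in> {..<m} - {i}" for j
    using Suc that assms(1)
    by (intro mult_left_mono divide_nonneg_pos) (auto simp: subgenerator_def simp del: unabsorbed.simps)
  then show ?case
    by (subst (1 2) unabsorbed.simps) (rule sum_mono)
qed

lemma kernel_bounded_by_unabsorbed:
  fixes v :: "nat \<Rightarrow> real"
  assumes T: "subgenerator m T" and ker: "\<And>i. i < m \<Longrightarrow> (\<Sum>j<m. T $$ (i, j) * v j) = 0"
    and C: "\<And>i. i < m \<Longrightarrow> \<bar>v i\<bar> \<le> C" and i: "i < m"
  shows "\<bar>v i\<bar> \<le> C * unabsorbed m T k i"
  using i
proof (induction k arbitrary: i)
  case 0
  then show ?case using C by simp
next
  case (Suc k)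
  have nn: "0 \<le> T $$ (i, j) / (- T $$ (i, i))" if "j \<in> {..<m} - {i}" for j
    using Suc.prems that T by (intro divide_nonneg_pos) (auto simp: subgenerator_def)
  have "\<bar>v i\<bar> = \<bar>\<Sum>j\<in>{..<m} - {i}. T $$ (i, j) / (- T $$ (i, i)) * v j\<bar>"
    using ker[OF Suc.prems] unfolding subgenerator_kernel_iff[OF T Suc.prems] by simp
  also have "\<dots> \<le> (\<Sum>j\<in>{..<m} - {i}. \<bar>T $$ (i, j) / (- T $$ (i, i)) * v j\<bar>)"
    by (rule sum_abs)
  also have "\<dots> \<le> (\<Sum>j\<in>{..<m} - {i}. T $$ (i, j) / (- T $$ (i, i)) * (C * unabsorbed m T k j))"
  proof (rule sum_mono)
    fix j assume j: "j \<in> {..<m} - {i}"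
    show "\<bar>T $$ (i, j) / (- T $$ (i, i)) * v j\<bar>
        \<le> T $$ (i, j) / (- T $$ (i, i)) * (C * unabsorbed m T k j)"
      unfolding abs_mult abs_of_nonneg[OF nn[OF j]]
      using j Suc.IH[of j] nn[OF j] by (intro mult_left_mono) auto
  qed
  also have "\<dots> = C * unabsorbed m T (Suc k) i"
    by (simp add: sum_distrib_left mult_ac)
  finally show ?case .
qed

lemma transient_subgenerator_iff_det:
  "transient_subgenerator m T \<longleftrightarrow> subgenerator m T \<and> Determinant.det T \<noteq> 0"
proof (cases "subgenerator m T")
  case T: True
  then have carr: "T \<in> carrier_mat m m" by (simp add: subgenerator_def)
  have mv: "vec_index (T *\<^sub>v v) i = (\<Sum>j<m. T $$ (i, j) * vec_index v j)"
    if "v \<in> carrier_vec m" "i < m" for v i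
    using carr that by (auto simp: scalar_prod_def lessThan_atLeast0)
  have "(\<forall>i<m. (\<lambda>k. unabsorbed m T k i) \<longlonglongrightarrow> 0) \<longleftrightarrow> Determinant.det T \<noteq> 0"
  proof (intro iffI notI)
    assume lim: "\<forall>i<m. (\<lambda>k. unabsorbed m T k i) \<longlonglongrightarrow> 0" and "Determinant.det T = 0"
    then obtain v where v: "v \<in> carrier_vec m" "v \<noteq> 0\<^sub>v m" "T *\<^sub>v v = 0\<^sub>v m"
      using det_0_iff_vec_prod_zero_field[OF carr] by auto
    have ker: "(\<Sum>j<m. T $$ (i, j) * vec_index v j) = 0" if "i < m" for i
      using mv[OF v(1) that] v(3) that by simp
    define C where "C = (\<Sum>i<m. \<bar>vec_index v i\<bar>)"
    have C: "\<bar>vec_index v i\<bar> \<le> C" if "i < m" for i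
      unfolding C_def using that by (intro member_le_sum) auto
    have "vec_index v i = 0" if i: "i < m" for i
    proof -
      have "(\<lambda>k. C * unabsorbed m T k i) \<longlonglongrightarrow> C * 0"
        using lim i by (intro tendsto_intros) auto
      then have "\<bar>vec_index v i\<bar> \<le> C * 0"
        by (rule LIMSEQ_le_const) (use kernel_bounded_by_unabsorbed[OF T ker C i] in auto)
      then show ?thesis by simp
    qed
    then have "v = 0\<^sub>v m" using v(1) by (intro eq_vecI) auto
    then show False using v(2) by simp
  next
    assume det: "Determinant.det T \<noteq> 0"
    define L where "L i = lim (\<lambda>k. unabsorbed m T k i)" for i
    have L: "(\<lambda>k. unabsorbed m T k i) \<longlonglongrightarrow> L i" if "i < m" for i
    proof -
      have "decseq (\<lambda>k. unabsorbed m T k i)"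
        using unabsorbed_Suc_le[OF T that] by (rule decseq_SucI)
      then have "convergent (\<lambda>k. unabsorbed m T k i)"
        using unabsorbed_nonneg[OF T that] by (metis convergentI decseq_convergent)
      then show ?thesis unfolding L_def by (simp add: convergent_LIMSEQ_iff)
    qed
    have "L i = (\<Sum>j\<in>{..<m} - {i}. T $$ (i, j) / (- T $$ (i, i)) * L j)" if "i < m" for i
    proof (rule LIMSEQ_unique)
      show "(\<lambda>k. unabsorbed m T (Suc k) i) \<longlonglongrightarrow> L i"
        using L[OF that] by (rule LIMSEQ_Suc)
      show "(\<lambda>k. unabsorbed m T (Suc k) i)
          \<longlonglongrightarrow> (\<Sum>j\<in>{..<m} - {i}. T $$ (i, j) / (- T $$ (i, i)) * L j)"
        unfolding unabsorbed.simps using L by (intro tendsto_sum tendsto_mult tendsto_const) auto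
    qed
    then have "(\<Sum>j<m. T $$ (i, j) * L j) = 0" if "i < m" for i
      using subgenerator_kernel_iff[OF T that] that by auto
    then have "T *\<^sub>v Matrix.vec m L = 0\<^sub>v m"
      using carr by (intro eq_vecI) (auto simp: scalar_prod_def lessThan_atLeast0)
    then have "Matrix.vec m L = 0\<^sub>v m"
      using det det_0_iff_vec_prod_zero_field[OF carr] by (metis vec_carrier)
    then have "L i = 0" if "i < m" for i
      using that by (metis index_vec index_zero_vec(1))
    then show "\<forall>i<m. (\<lambda>k. unabsorbed m T k i) \<longlonglongrightarrow> 0"
      using L by metis
  qed
  then show ?thesis using T by (simp add: transient_subgenerator_def)
qed (simp add: transient_subgenerator_def)

subsection \<open>The class MPH*\<close>

text \<open>
  The reward matrix is given by its rows \<open>K i\<close>, so the \<open>i\<close>-th entry of \<open>K s\<close> is \<open>K i \<bullet> s\<close>.  For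
  \<open>s \<ge> 0\<close> the matrix passed to \<^const>\<open>mat_inverse\<close> is nonsingular, because it is the negative of a
  transient subgenerator.  Nonnegativity of \<open>Y\<close> is required almost surely, so that membership
  depends on the law of \<open>Y\<close> only.
\<close>

definition mph_transform ::
    "nat \<Rightarrow> real Matrix.vec \<Rightarrow> real mat \<Rightarrow> (nat \<Rightarrow> real ^ 'n) \<Rightarrow> real ^ 'n \<Rightarrow> real" where
  "mph_transform m \<alpha> T K s =
     (let one = Matrix.vec m (\<lambda>_. 1); t = - (T *\<^sub>v one); p\<^sub>0 = 1 - scalar_prod \<alpha> one
      in p\<^sub>0 + scalar_prod \<alpha> (the (mat_inverse (- T + mat_diag m (\<lambda>i. K i \<bullet> s))) *\<^sub>v t))"

definition mph_star :: "'w measure \<Rightarrow> ('w \<Rightarrow> real ^ 'n) set" where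
  "mph_star M = {Y \<in> borel_measurable M.
     (AE \<omega> in M. \<forall>j. 0 \<le> Y \<omega> $ j) \<and>
     (\<exists>m \<alpha> T K. 1 \<le> m \<and>
        \<alpha> \<in> carrier_vec m \<and> (\<forall>i<m. 0 \<le> vec_index \<alpha> i) \<and> (\<Sum>i<m. vec_index \<alpha> i) \<le> 1 \<and>
        transient_subgenerator m T \<and>
        (\<forall>i<m. \<forall>j. 0 \<le> K i $ j) \<and>
        (\<forall>s. (\<forall>j. 0 \<le> s $ j) \<longrightarrow>
          integral\<^sup>L M (\<lambda>\<omega>. exp (- (s \<bullet> Y \<omega>))) = mph_transform m \<alpha> T K s))}"

end

theory Submission
  imports Defs
begin

text \<open>
  Write \<open>B(s) = s\<^sub>1 H\<^sub>1 + s\<^sub>2 H\<^sub>2 + s\<^sub>3 H\<^sub>3\<close>, so that \<open>\<langle>s, X\<rangle> = Tr (B(s) Z)\<close> and the transform of \<open>X\<close> is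
  \<open>1 / q(s)\<close> with \<open>q(s) = det (I + B(s))\<close>.  The map \<open>s \<mapsto> B(s)\<close> is a linear bijection onto the symmetric
  matrices.  Geometrically, the support of \<open>X\<close> is a linear image of the positive semidefinite
  cone, which is round, whereas the support of a vector of class MPH* is a finite union of
  polyhedral cones: the vector is a sum of occupation times of the phases, weighted with the
  reward vectors \<open>K\<^sub>i\<close>.  The proof turns this into a statement about the dual cones that
  can be read off the transform.

  Suppose \<open>1 / q\<close> is the transform of an MPH* representation, and let \<open>\<K>\<close> be the set of reward
  vectors of the phases that can be reached from the initial distribution.  Two facts
  (\<open>mph_star_reward_cone\<close>) connect \<open>q\<close> with \<open>\<K>\<close>.

  If \<open>k \<bullet> s \<ge> 0\<close> for all \<open>k \<in> \<K>\<close>, then \<open>q(s) \<noteq> 0\<close> (\<open>nonvanishing\<close>).  The transform of the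
  representation is \<open>p\<^sub>0 + \<alpha> x\<close>, where \<open>x\<close> solves \<open>(-T + \<Delta>(K s)) x = t\<close>.  A comparison principle for
  such M-matrix systems (\<open>comparison\<close>) makes this system uniquely solvable whenever \<open>K s \<ge> 0\<close>, even if
  \<open>s\<close> has negative entries, and by Cramer's rule the identity \<open>(p\<^sub>0 + \<alpha> x) q(s) = 1\<close> is polynomial and
  so persists there (\<open>transform_extends\<close>).

  If \<open>q \<ge> 1\<close> on the ray spanned by \<open>c\<close>, then \<open>k \<bullet> c \<ge> 0\<close> for all \<open>k \<in> \<K>\<close> (\<open>reward_nonneg_direction\<close>).
  Here one follows the solution \<open>x\<close> along the ray.  It stays positive, and since
  \<open>p\<^sub>0 + \<alpha> x = 1 / q \<le> 1\<close> it stays bounded at every reachable phase, so it never ceases to exist;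
  but a phase with \<open>k \<bullet> c < 0\<close> would let it exist only for a bounded stretch of the ray.

  For \<open>v = (1, x)\<close> let \<open>c\<^sub>x\<close> be the vector with \<open>B(c\<^sub>x) = v v\<^sup>T\<close>.  Then \<open>q(r c\<^sub>x) = 1 + r (1 + x\<^sup>2)\<close>,
  so all \<open>k \<in> \<K>\<close> are nonnegative on all \<open>c\<^sub>x\<close>.  A nonzero \<open>k\<close> vanishes at \<open>c\<^sub>x\<close> for at most two
  values of \<open>x\<close>, so some \<open>x\<close> has \<open>k \<bullet> c\<^sub>x > 0\<close> for all nonzero \<open>k \<in> \<K>\<close>: the polyhedral cone dual to \<open>\<K>\<close>
  contains a neighbourhood of \<open>c\<^sub>x\<close>, although \<open>c\<^sub>x\<close> is on the boundary of the set of \<open>s\<close> with \<open>B(s)\<close>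
  positive semidefinite.  For \<open>r\<close> large, \<open>s = r c\<^sub>x - (1, 0, 0)\<close> then has \<open>k \<bullet> s \<ge> 0\<close> for all
  \<open>k \<in> \<K>\<close>, but \<open>I + B(s) = r v v\<^sup>T\<close> is singular, that is, \<open>q(s) = 0\<close>, a contradiction.
\<close>

section \<open>Absorbing linear systems with killing\<close>

text \<open>
  The least ratio \<open>w\<^sub>j / y\<^sub>j\<close> over the \<open>j\<close> with \<open>y\<^sub>j > 0\<close> is the first multiple of \<open>y\<close> that touches
  \<open>w\<close> from below.
\<close>

lemma exists_tight_multiple:
  fixes w y :: "'i \<Rightarrow> real"
  assumes "finite I" "\<And>j. j \<in> I \<Longrightarrow> 0 < w j" "i \<in> I" "0 < y i"
  obtains \<beta> j where "0 < \<beta>" "\<And>k. k \<in> I \<Longrightarrow> \<beta> * y k \<le> w k" "j \<in> I" "\<beta> * y j = w j"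
proof -
  define \<gamma> where "\<gamma> = Max ((\<lambda>k. y k / w k) ` I)"
  have le: "y k / w k \<le> \<gamma>" if "k \<in> I" for k
    unfolding \<gamma>_def using assms(1) that by (intro Max_ge) auto
  have "\<gamma> \<in> (\<lambda>k. y k / w k) ` I"
    unfolding \<gamma>_def using assms(1,3) by (intro Max_in) auto
  then obtain j where j: "j \<in> I" "\<gamma> = y j / w j" by auto
  have "0 < y i / w i" using assms by simp
  also have "\<dots> \<le> \<gamma>" by (rule le[OF assms(3)])
  finally have pos: "0 < \<gamma>" .
  show thesis
  proof (rule that[of "1 / \<gamma>" j])
    show "1 / \<gamma> * y k \<le> w k" if "k \<in> I" for k
      using le[OF that] assms(2)[OF that] pos by (simp add: field_simps)
    show "1 / \<gamma> * y j = w j"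
      using j assms(2)[OF j(1)] pos by (simp add: field_simps)
    show "0 < 1 / \<gamma>" using pos by simp
  qed (rule j)
qed

lemma det_polynomial:
  fixes A :: "real \<Rightarrow> real mat"
  assumes carr: "\<And>u. A u \<in> carrier_mat m m"
    and entries: "\<And>i j. i < m \<Longrightarrow> j < m \<Longrightarrow> \<exists>p. \<forall>u. A u $$ (i, j) = poly p u"
  shows "\<exists>p. \<forall>u. Determinant.det (A u) = poly p u"
proof -
  obtain P where P: "\<And>i j u. i < m \<Longrightarrow> j < m \<Longrightarrow> A u $$ (i, j) = poly (P i j) u"
    using entries by metis
  have "Determinant.det (A u)
      = poly (\<Sum>\<pi> | \<pi> permutes {0..<m}. of_int (sign \<pi>) * (\<Prod>i = 0..<m. P i (\<pi> i))) u" for u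
  proof -
    have "(\<Prod>i = 0..<m. A u $$ (i, \<pi> i)) = (\<Prod>i = 0..<m. poly (P i (\<pi> i)) u)"
      if "\<pi> permutes {0..<m}" for \<pi>
      using permutes_in_image[OF that] by (intro prod.cong refl P) auto
    then show ?thesis
      by (simp add: det_def'[OF carr] poly_sum poly_prod)
  qed
  then show ?thesis by blast
qed

text \<open>
  The states of a finite Markov chain with jump rates \<open>T i j\<close>.  The condition \<open>escape\<close> is transience
  in combinatorial form: from some state of every nonempty set the chain can jump to absorption or to a
  state outside the set.
\<close>

locale absorbing_system =
  fixes I :: "nat set" and T :: "nat \<Rightarrow> nat \<Rightarrow> real"
  assumes finite_states: "finite I"
    and offdiag_nonneg: "i \<in> I \<Longrightarrow> j \<in> I \<Longrightarrow> i \<noteq> j \<Longrightarrow> 0 \<le> T i j"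
    and row_sum_nonpos: "i \<in> I \<Longrightarrow> (\<Sum>j\<in>I. T i j) \<le> 0"
    and escape: "S \<subseteq> I \<Longrightarrow> S \<noteq> {} \<Longrightarrow>
      \<exists>i\<in>S. (\<Sum>j\<in>I. T i j) < 0 \<or> (\<exists>j\<in>I - S. 0 < T i j)"
begin

definition exit_rate :: "nat \<Rightarrow> real" where
  "exit_rate i = - (\<Sum>j\<in>I. T i j)"

text \<open>
  The matrix \<open>-T + \<Delta>(\<kappa>)\<close> applied to \<open>x\<close>.  For \<open>\<kappa> \<ge> 0\<close> this is the generator, up to sign, of the chain
  killed in state \<open>i\<close> at the additional rate \<open>\<kappa> i\<close>; what follows admits negative \<open>\<kappa>\<close>.
\<close>

definition killed :: "(nat \<Rightarrow> real) \<Rightarrow> (nat \<Rightarrow> real) \<Rightarrow> nat \<Rightarrow> real" where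
  "killed \<kappa> x i = \<kappa> i * x i - (\<Sum>j\<in>I. T i j * x j)"

text \<open>
  For \<open>\<kappa> \<ge> 0\<close> the solution at \<open>i\<close> is the probability that the chain started in \<open>i\<close> is absorbed
  before it is killed.
\<close>

definition solution :: "(nat \<Rightarrow> real) \<Rightarrow> (nat \<Rightarrow> real) \<Rightarrow> bool" where
  "solution \<kappa> x \<longleftrightarrow> (\<forall>i\<in>I. killed \<kappa> x i = exit_rate i)"

text \<open>
  The existence of a supersolution is the form in which the nonsingularity of the M-matrix
  \<open>-T + \<Delta>(\<kappa>)\<close> enters; unlike the condition \<open>\<kappa> \<ge> 0\<close> it can hold for \<open>\<kappa>\<close> with negative entries.
\<close>

definition supersolution :: "(nat \<Rightarrow> real) \<Rightarrow> (nat \<Rightarrow> real) \<Rightarrow> bool" where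
  "supersolution \<kappa> w \<longleftrightarrow> (\<forall>i\<in>I. 0 \<le> w i \<and> exit_rate i \<le> killed \<kappa> w i)"

lemma solution_supersolution:
  "solution \<kappa> x \<Longrightarrow> (\<And>i. i \<in> I \<Longrightarrow> 0 \<le> x i) \<Longrightarrow> supersolution \<kappa> x"
  by (simp add: solution_def supersolution_def)

lemma exit_rate_nonneg: "i \<in> I \<Longrightarrow> 0 \<le> exit_rate i"
  using row_sum_nonpos by (simp add: exit_rate_def)

lemma killed_linear: "killed \<kappa> (\<lambda>j. a * x j + b * y j) i = a * killed \<kappa> x i + b * killed \<kappa> y i"
  by (simp add: killed_def algebra_simps sum.distrib sum_distrib_left)

lemma killed_one: "killed \<kappa> (\<lambda>_. 1) i = \<kappa> i + exit_rate i"
  by (simp add: killed_def exit_rate_def)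

lemma one_supersolution: "(\<And>i. i \<in> I \<Longrightarrow> 0 \<le> \<kappa> i) \<Longrightarrow> supersolution \<kappa> (\<lambda>_. 1)"
  by (simp add: supersolution_def killed_one)

lemma killed_diag:
  assumes "i \<in> I"
  shows "killed \<kappa> x i = (\<kappa> i - T i i) * x i - (\<Sum>j\<in>I - {i}. T i j * x j)"
  using assms by (simp add: killed_def sum.remove[OF finite_states assms] algebra_simps)

text \<open>
  At a zero \<open>i\<close> of \<open>z\<close> the operator takes the value \<open>- \<Sum>\<^sub>j T i j z\<^sub>j \<le> 0\<close>, so the exit rate is zero and
  \<open>z\<close> vanishes at all successors: the set of zeros could not be left, contrary to \<open>escape\<close>.
\<close>

lemma supersolution_positive:
  assumes z: "supersolution \<kappa> z" and "i \<in> I"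
  shows "0 < z i"
proof (rule ccontr)
  have nonneg: "0 \<le> z j" and super: "exit_rate j \<le> killed \<kappa> z j" if "j \<in> I" for j
    using z that by (auto simp: supersolution_def)
  define S where "S = {i \<in> I. z i = 0}"
  assume "\<not> 0 < z i"
  with nonneg[of i] \<open>i \<in> I\<close> have "S \<noteq> {}" by (force simp: S_def)
  moreover have "S \<subseteq> I" by (auto simp: S_def)
  ultimately obtain k where k: "k \<in> S"
    and esc: "(\<Sum>j\<in>I. T k j) < 0 \<or> (\<exists>j\<in>I - S. 0 < T k j)" using escape by blast
  from k have kI: "k \<in> I" and zk: "z k = 0" by (auto simp: S_def)
  have terms: "0 \<le> T k j * z j" if "j \<in> I - {k}" for j
    using that offdiag_nonneg[OF kI] nonneg by auto
  have le: "exit_rate k \<le> - (\<Sum>j\<in>I - {k}. T k j * z j)"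
    using super[OF kI] by (simp add: killed_diag[OF kI] zk)
  from esc show False
  proof
    assume "(\<Sum>j\<in>I. T k j) < 0"
    then have "0 < exit_rate k" by (simp add: exit_rate_def)
    with le sum_nonneg[of "I - {k}" "\<lambda>j. T k j * z j"] terms show False by fastforce
  next
    assume "\<exists>j\<in>I - S. 0 < T k j"
    then obtain j where j: "j \<in> I" "j \<notin> S" "0 < T k j" by blast
    then have "0 < z j" using nonneg[of j] by (auto simp: S_def less_le)
    then have "0 < T k j * z j" using j by simp
    also have "\<dots> \<le> (\<Sum>j\<in>I - {k}. T k j * z j)"
      using j k terms finite_states by (intro member_le_sum) auto
    finally show False using le exit_rate_nonneg[OF kI] by linarith
  qed
qed

text \<open>
  If \<open>y\<close> were positive somewhere, its largest multiple below \<open>w\<close> could be subtracted from \<open>w\<close>, which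
  gives a supersolution with a zero.
\<close>

lemma comparison:
  assumes w: "supersolution \<kappa> w"
    and y: "\<And>i. i \<in> I \<Longrightarrow> killed \<kappa> y i \<le> 0"
    and "i \<in> I"
  shows "y i \<le> 0"
proof (rule ccontr)
  assume "\<not> y i \<le> 0"
  then obtain \<beta> j where \<beta>: "0 < \<beta>" "\<And>k. k \<in> I \<Longrightarrow> \<beta> * y k \<le> w k" "j \<in> I" "\<beta> * y j = w j"
    using exists_tight_multiple[OF finite_states supersolution_positive[OF w] \<open>i \<in> I\<close>, where y = y]
    by force
  define z where "z = (\<lambda>k. 1 * w k + (- \<beta>) * y k)"
  have "exit_rate k \<le> killed \<kappa> z k" if "k \<in> I" for k
  proof -
    have "exit_rate k \<le> killed \<kappa> w k" using w that by (simp add: supersolution_def)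
    then show ?thesis
      using y[OF that] \<beta>(1) mult_nonneg_nonpos[of \<beta> "killed \<kappa> y k"]
      unfolding z_def killed_linear by simp
  qed
  moreover have "0 \<le> z k" if "k \<in> I" for k using \<beta>(2)[OF that] by (simp add: z_def)
  ultimately have "0 < z j" using supersolution_positive[of \<kappa> z j] \<beta>(3) by (simp add: supersolution_def)
  then show False using \<beta>(4) by (simp add: z_def)
qed

lemma killed_injective:
  assumes w: "supersolution \<kappa> w"
    and y: "\<And>i. i \<in> I \<Longrightarrow> killed \<kappa> y i = 0"
    and i: "i \<in> I"
  shows "y i = 0"
proof -
  have "killed \<kappa> (\<lambda>j. (- 1) * y j + 0 * y j) k = 0" if "k \<in> I" for k
    unfolding killed_linear using y[OF that] by simp
  then show ?thesis
    using comparison[OF w y[THEN eq_refl] i]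
      comparison[OF w, of "\<lambda>j. (- 1) * y j + 0 * y j" i] i by simp
qed

text \<open>
  \<open>D \<kappa>\<close> is the determinant of \<open>-T + \<Delta>(\<kappa>)\<close> and \<open>N \<kappa> i\<close> the numerator in Cramer's rule for the solution.
  They are polynomials along every line, which is what analytic continuation in \<open>\<kappa>\<close> and continuity
  of the solution will rest on.
\<close>

lemma obtain_cramer:
  obtains D :: "(nat \<Rightarrow> real) \<Rightarrow> real" and N :: "(nat \<Rightarrow> real) \<Rightarrow> nat \<Rightarrow> real"
  where "\<And>\<kappa> w. supersolution \<kappa> w \<Longrightarrow> D \<kappa> \<noteq> 0"
    and "\<And>\<kappa>. D \<kappa> \<noteq> 0 \<Longrightarrow> \<exists>x. solution \<kappa> x"
    and "\<And>\<kappa> x i. solution \<kappa> x \<Longrightarrow> i \<in> I \<Longrightarrow> x i * D \<kappa> = N \<kappa> i"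
    and "\<And>a b. \<exists>p. \<forall>u. D (\<lambda>i. a i + u * b i) = poly p u"
    and "\<And>a b i. i \<in> I \<Longrightarrow> \<exists>p. \<forall>u. N (\<lambda>i. a i + u * b i) i = poly p u"
proof -
  obtain m where m: "I \<subseteq> {0..<m}" using finite_states
    by (metis finite_nat_set_iff_bounded atLeastLessThan_iff subsetI zero_le)
  \<comment> \<open>The matrix carries indices \<open>0..<m\<close>; outside \<open>I\<close> it is padded with the identity.\<close>
  define A where "A \<kappa> = Matrix.mat m m (\<lambda>(i, j). if i \<in> I \<and> j \<in> I
    then (if i = j then \<kappa> i else 0) - T i j else if i = j then 1 else 0)" for \<kappa>
  define b where "b = Matrix.vec m (\<lambda>i. if i \<in> I then exit_rate i else 0)"
  have carr: "A \<kappa> \<in> carrier_mat m m" for \<kappa> by (simp add: A_def)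
  have b_carr: "b \<in> carrier_vec m" by (simp add: b_def)
  have mv: "vec_index (A \<kappa> *\<^sub>v v) i = (if i \<in> I then killed \<kappa> (vec_index v) i else vec_index v i)"
    if v: "v \<in> carrier_vec m" and i: "i < m" for \<kappa> v i
  proof -
    have "vec_index (A \<kappa> *\<^sub>v v) i = (\<Sum>j = 0..<m. A \<kappa> $$ (i, j) * vec_index v j)"
      using v i carr[of \<kappa>] by (auto simp: scalar_prod_def intro!: sum.cong)
    also have "\<dots> = (if i \<in> I then killed \<kappa> (vec_index v) i else vec_index v i)"
    proof (cases "i \<in> I")
      case True
      have "(\<Sum>j = 0..<m. A \<kappa> $$ (i, j) * vec_index v j) = (\<Sum>j\<in>I. A \<kappa> $$ (i, j) * vec_index v j)"
        using True m i by (intro sum.mono_neutral_right) (auto simp: A_def)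
      also have "\<dots> = (\<Sum>j\<in>I. (if i = j then \<kappa> i * vec_index v i else 0) - T i j * vec_index v j)"
        using True m i by (intro sum.cong) (auto simp: A_def algebra_simps)
      also have "\<dots> = killed \<kappa> (vec_index v) i"
        using True finite_states by (simp add: sum_subtractf killed_def)
      finally show ?thesis using True by simp
    next
      case False
      have "(\<Sum>j = 0..<m. A \<kappa> $$ (i, j) * vec_index v j) = (\<Sum>j = 0..<m. if i = j then vec_index v j else 0)"
        using False i by (intro sum.cong) (auto simp: A_def)
      then show ?thesis using False i by simp
    qed
    finally show ?thesis .
  qed
  have killed_cong: "killed \<kappa> x i = killed \<kappa> y i" if "\<And>j. j \<in> I \<Longrightarrow> x j = y j" "i \<in> I" for \<kappa> x y i
    using that by (simp add: killed_def)
  show thesis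
  proof
    fix \<kappa> w assume w: "supersolution \<kappa> w"
    show "Determinant.det (A \<kappa>) \<noteq> 0"
    proof
      assume "Determinant.det (A \<kappa>) = 0"
      then obtain v where v: "v \<in> carrier_vec m" "v \<noteq> 0\<^sub>v m" "A \<kappa> *\<^sub>v v = 0\<^sub>v m"
        using det_0_iff_vec_prod_zero_field[OF carr] by auto
      have eq: "(if i \<in> I then killed \<kappa> (vec_index v) i else vec_index v i) = 0" if "i < m" for i
        using mv[OF v(1) that, of \<kappa>] v(3) that by simp
      obtain i where i: "i < m" "vec_index v i \<noteq> 0"
        using v(1,2) by (metis carrier_vecD eq_vecI index_zero_vec)
      have "killed \<kappa> (vec_index v) j = 0" if "j \<in> I" for j
        using eq[of j] that m by auto
      then have "vec_index v j = 0" if "j \<in> I" for j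
        using killed_injective[OF w] that by blast
      then show False using i eq[of i] by (auto split: if_splits)
    qed
  next
    fix \<kappa> assume "Determinant.det (A \<kappa>) \<noteq> 0"
    then have "A \<kappa> \<in> Units (ring_mat TYPE(real) m ())"
      by (rule det_non_zero_imp_unit[OF carr])
    then obtain B where B: "B \<in> carrier_mat m m" "A \<kappa> * B = 1\<^sub>m m"
      by (auto simp: Units_def ring_mat_def)
    then have "A \<kappa> *\<^sub>v (B *\<^sub>v b) = b"
      using carr[of \<kappa>] b_carr by (metis assoc_mult_mat_vec one_mult_mat_vec)
    moreover have "B *\<^sub>v b \<in> carrier_vec m" using B b_carr by auto
    ultimately have "killed \<kappa> (vec_index (B *\<^sub>v b)) i = exit_rate i" if "i \<in> I" for i
      using mv[of "B *\<^sub>v b" i \<kappa>] that m by (auto simp: b_def)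
    then show "\<exists>x. solution \<kappa> x" unfolding solution_def by blast
  next
    fix \<kappa> x i
    assume x: "solution \<kappa> x" and i: "i \<in> I"
    define v where "v = Matrix.vec m (\<lambda>i. if i \<in> I then x i else 0)"
    have v: "v \<in> carrier_vec m" by (simp add: v_def)
    have "A \<kappa> *\<^sub>v v = b"
    proof (rule eq_vecI)
      fix j assume "j < dim_vec b"
      then have j: "j < m" by (simp add: b_def)
      have "killed \<kappa> (vec_index v) j = killed \<kappa> x j" if "j \<in> I"
        using m that by (intro killed_cong) (auto simp: v_def)
      then show "vec_index (A \<kappa> *\<^sub>v v) j = vec_index b j"
        using j x unfolding mv[OF v j] by (auto simp: b_def v_def solution_def)
    qed (use carr[of \<kappa>] in \<open>auto simp: b_def\<close>)
    then show "x i * Determinant.det (A \<kappa>) = Determinant.det (replace_col (A \<kappa>) b i)"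
      using cramer_lemma_mat[OF carr v, of i \<kappa>] i m by (auto simp: v_def)
  next
    fix a c :: "nat \<Rightarrow> real"
    have ent: "\<exists>p. \<forall>u. A (\<lambda>i. a i + u * c i) $$ (i, j) = poly p u" if "i < m" "j < m" for i j
      using that by (intro exI[of _ "if i \<in> I \<and> j \<in> I
        then (if i = j then [:a i, c i:] else 0) - [:T i j:] else if i = j then 1 else 0"])
        (auto simp: A_def)
    then show "\<exists>p. \<forall>u. Determinant.det (A (\<lambda>i. a i + u * c i)) = poly p u"
      by (intro det_polynomial[OF carr])
    fix k
    show "\<exists>p. \<forall>u. Determinant.det (replace_col (A (\<lambda>i. a i + u * c i)) b k) = poly p u"
    proof (rule det_polynomial)
      show "replace_col (A (\<lambda>i. a i + u * c i)) b k \<in> carrier_mat m m" for u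
        by (simp add: replace_col_def A_def)
      fix i j assume ij: "i < m" "j < m"
      show "\<exists>p. \<forall>u. replace_col (A (\<lambda>i. a i + u * c i)) b k $$ (i, j) = poly p u"
      proof (cases "j = k")
        case True
        then show ?thesis using ij by (intro exI[of _ "[:vec_index b i:]"]) (auto simp: replace_col_def A_def)
      next
        case False
        then have "replace_col (A (\<lambda>i. a i + u * c i)) b k $$ (i, j) = A (\<lambda>i. a i + u * c i) $$ (i, j)" for u
          using ij by (auto simp: replace_col_def A_def)
        then show ?thesis using ent[OF ij] by presburger
      qed
    qed
  qed
qed

lemma solution_exists:
  assumes w: "supersolution \<kappa> w"
  obtains x where "solution \<kappa> x"
  by (rule obtain_cramer) (use w in blast)

end

text \<open>
  Bolzano-Weierstrass in a product of intervals over a finite index set.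
\<close>

lemma bounded_family_subsequence:
  fixes X :: "nat \<Rightarrow> 'i \<Rightarrow> real"
  assumes "finite I" "\<And>n i. i \<in> I \<Longrightarrow> \<bar>X n i\<bar> \<le> C i"
  shows "\<exists>\<sigma> L. strict_mono \<sigma> \<and> (\<forall>i\<in>I. (\<lambda>n. X (\<sigma> n) i) \<longlonglongrightarrow> L i)"
  using assms
proof (induction I)
  case empty
  show ?case by (intro exI[of _ id]) (simp add: strict_mono_id)
next
  case (insert a I)
  then obtain \<sigma> L where \<sigma>: "strict_mono \<sigma>" and L: "\<forall>i\<in>I. (\<lambda>n. X (\<sigma> n) i) \<longlonglongrightarrow> L i"
    by auto
  have "bounded (range (\<lambda>n. X (\<sigma> n) a))"
    using insert.prems by (intro boundedI[of _ "C a"]) auto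
  then obtain l \<tau> where \<tau>: "strict_mono \<tau>" and l: "((\<lambda>n. X (\<sigma> n) a) \<circ> \<tau>) \<longlonglongrightarrow> l"
    using bounded_imp_convergent_subsequence by blast
  show ?case
  proof (intro exI[of _ "\<sigma> \<circ> \<tau>"] exI[of _ "L(a := l)"] conjI ballI)
    show "strict_mono (\<sigma> \<circ> \<tau>)" using \<sigma> \<tau> by (simp add: strict_mono_o)
    fix i assume "i \<in> insert a I"
    then show "(\<lambda>n. X ((\<sigma> \<circ> \<tau>) n) i) \<longlonglongrightarrow> (L(a := l)) i"
      using l L insert.hyps LIMSEQ_subseq_LIMSEQ[OF _ \<tau>, of "\<lambda>n. X (\<sigma> n) i" "L i"]
      by (auto simp: o_def)
  qed
qed

section \<open>The transform of a system with rewards\<close>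

text \<open>
  An absorbing system with reward vectors \<open>K i\<close> in which every state can be reached from the initial
  weights \<open>\<alpha>\<close> (stated as an induction principle), and whose phase-type transform
  \<open>p\<^sub>0 + \<alpha> (-T + \<Delta>(K s))\<^sup>-\<^sup>1 t\<close> is \<open>1 / q(s)\<close> for \<open>s \<ge> 0\<close>.
\<close>

locale rewarded_system = absorbing_system I T for I T +
  fixes \<alpha> :: "nat \<Rightarrow> real" and p\<^sub>0 :: real and K :: "nat \<Rightarrow> real ^ 'n" and q :: "real ^ 'n \<Rightarrow> real"
  assumes initial_nonneg: "i \<in> I \<Longrightarrow> 0 \<le> \<alpha> i"
    and defect_nonneg: "0 \<le> p\<^sub>0"
    and reward_nonneg: "i \<in> I \<Longrightarrow> 0 \<le> K i $ j"
    and accessible: "B \<subseteq> I \<Longrightarrow> (\<And>i. i \<in> I \<Longrightarrow> 0 < \<alpha> i \<Longrightarrow> i \<in> B) \<Longrightarrow>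
      (\<And>i j. i \<in> B \<Longrightarrow> j \<in> I \<Longrightarrow> 0 < T i j \<Longrightarrow> j \<in> B) \<Longrightarrow> B = I"
    and polynomial_on_lines: "\<exists>p. \<forall>u. q (a + u *\<^sub>R b) = poly p u"
    and transform: "(\<And>j. 0 \<le> s $ j) \<Longrightarrow> solution (\<lambda>i. K i \<bullet> s) x \<Longrightarrow>
      (p\<^sub>0 + (\<Sum>i\<in>I. \<alpha> i * x i)) * q s = 1"
begin

text \<open>
  Multiplied by the determinant, the identity is one between polynomials on the line through \<open>s\<close> and
  \<open>(1, \<dots>, 1)\<close>.  It holds near \<open>(1, \<dots>, 1)\<close>, which is an interior point of the orthant, hence at \<open>s\<close>;
  there the determinant may be cancelled because of the supersolution.
\<close>

lemma transform_extends:
  assumes w: "supersolution (\<lambda>i. K i \<bullet> s) w" and x: "solution (\<lambda>i. K i \<bullet> s) x"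
  shows "(p\<^sub>0 + (\<Sum>i\<in>I. \<alpha> i * x i)) * q s = 1"
proof -
  obtain D N where nonsingular: "\<And>\<kappa> w. supersolution \<kappa> w \<Longrightarrow> D \<kappa> \<noteq> 0"
    and cramer: "\<And>\<kappa> x i. solution \<kappa> x \<Longrightarrow> i \<in> I \<Longrightarrow> x i * D \<kappa> = N \<kappa> i"
    and D_poly: "\<And>a b. \<exists>p. \<forall>u. D (\<lambda>i. a i + u * b i) = poly p u"
    and N_poly: "\<And>a b i. i \<in> I \<Longrightarrow> \<exists>p. \<forall>u. N (\<lambda>i. a i + u * b i) i = poly p u"
    by (rule obtain_cramer) blast
  have cleared: "(p\<^sub>0 * D \<kappa> + (\<Sum>i\<in>I. \<alpha> i * N \<kappa> i)) = D \<kappa> * (p\<^sub>0 + (\<Sum>i\<in>I. \<alpha> i * x i))"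
    if "solution \<kappa> x" for \<kappa> x
  proof -
    have "(\<Sum>i\<in>I. \<alpha> i * N \<kappa> i) = (\<Sum>i\<in>I. D \<kappa> * (\<alpha> i * x i))"
      using cramer[OF that] by (intro sum.cong) (auto simp: mult_ac)
    then show ?thesis by (simp add: sum_distrib_left algebra_simps)
  qed
  define o1 :: "real ^ 'n" where "o1 = (\<chi> i. 1)"
  define d where "d = s - o1"
  define \<kappa> where "\<kappa> u = (\<lambda>i. K i \<bullet> (o1 + u *\<^sub>R d))" for u
  have \<kappa>: "\<kappa> u = (\<lambda>i. K i \<bullet> o1 + u * (K i \<bullet> d))" for u
    by (simp add: \<kappa>_def inner_add_right)
  obtain PD where PD: "\<And>u. D (\<kappa> u) = poly PD u"
    using D_poly[of "\<lambda>i. K i \<bullet> o1" "\<lambda>i. K i \<bullet> d"] by (auto simp: \<kappa>)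
  have "\<forall>i\<in>I. \<exists>p. \<forall>u. N (\<kappa> u) i = poly p u"
    using N_poly[of _ "\<lambda>i. K i \<bullet> o1" "\<lambda>i. K i \<bullet> d"] by (auto simp: \<kappa>)
  from bchoice[OF this] obtain PN where PN: "\<And>i u. i \<in> I \<Longrightarrow> N (\<kappa> u) i = poly (PN i) u"
    by blast
  obtain Q where Q: "\<And>u. q (o1 + u *\<^sub>R d) = poly Q u" using polynomial_on_lines by metis
  define P where "P = Q * ([:p\<^sub>0:] * PD + (\<Sum>i\<in>I. [:\<alpha> i:] * PN i)) - PD"
  have P: "poly P u = q (o1 + u *\<^sub>R d) * (p\<^sub>0 * D (\<kappa> u) + (\<Sum>i\<in>I. \<alpha> i * N (\<kappa> u) i)) - D (\<kappa> u)" for u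
    by (simp add: P_def poly_sum PD PN Q)
  \<comment> \<open>The entries of \<open>o1 + u d\<close> are at least \<open>1 - u |d|\<close>, so \<open>u \<le> \<delta>\<close> keeps them nonnegative.\<close>
  define \<delta> where "\<delta> = 1 / (1 + norm d)"
  have \<delta>: "0 < \<delta>" by (simp add: \<delta>_def add_pos_nonneg)
  have "poly P u = 0" if u: "u \<in> {0..\<delta>}" for u
  proof -
    have nn: "0 \<le> (o1 + u *\<^sub>R d) $ j" for j
    proof -
      have "\<bar>u * d $ j\<bar> \<le> \<delta> * norm d"
        unfolding abs_mult using u component_le_norm_cart[of d j] by (intro mult_mono) auto
      also have "\<dots> \<le> 1" by (simp add: \<delta>_def field_simps add_pos_nonneg)
      finally show ?thesis by (simp add: o1_def)
    qed
    have "0 \<le> \<kappa> u i" if "i \<in> I" for i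
      unfolding \<kappa>_def inner_vec_def using reward_nonneg[OF that] nn by (auto intro!: sum_nonneg)
    then obtain y where y: "solution (\<kappa> u) y"
      using solution_exists[OF one_supersolution] by blast
    have "(p\<^sub>0 + (\<Sum>i\<in>I. \<alpha> i * y i)) * q (o1 + u *\<^sub>R d) = 1"
      using transform[OF nn] y by (simp add: \<kappa>_def)
    then show ?thesis
      unfolding P cleared[OF y] by (simp add: mult.commute mult.left_commute)
  qed
  then have "infinite {u. poly P u = 0}"
    using infinite_Icc[OF \<delta>] finite_subset[of "{0..\<delta>}" "{u. poly P u = 0}"] by blast
  then have "P = 0" using poly_roots_finite by blast
  then have "poly P 1 = 0" by simp
  moreover have "o1 + 1 *\<^sub>R d = s" by (simp add: d_def)
  moreover have "\<kappa> 1 = (\<lambda>i. K i \<bullet> s)" by (simp add: \<kappa>_def d_def)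
  moreover have "D (\<lambda>i. K i \<bullet> s) \<noteq> 0"
    by (rule nonsingular[OF w])
  ultimately show ?thesis
    unfolding P using cleared[OF x] by (simp add: mult.commute)
qed

text \<open>
  The constant \<open>1\<close> is a supersolution as soon as \<open>K s \<ge> 0\<close>.
\<close>

lemma nonvanishing:
  assumes "\<And>i. i \<in> I \<Longrightarrow> 0 \<le> K i \<bullet> s"
  shows "q s \<noteq> 0"
proof -
  have w: "supersolution (\<lambda>i. K i \<bullet> s) (\<lambda>_. 1)"
    by (rule one_supersolution) (rule assms)
  then obtain x where "solution (\<lambda>i. K i \<bullet> s) x" by (rule solution_exists)
  from transform_extends[OF w this] show ?thesis by auto
qed

definition nonneg_solution :: "real ^ 'n \<Rightarrow> (nat \<Rightarrow> real) \<Rightarrow> bool" where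
  "nonneg_solution s x \<longleftrightarrow> solution (\<lambda>i. K i \<bullet> s) x \<and> (\<forall>i\<in>I. 0 \<le> x i)"

lemma nonneg_solutionD:
  assumes "nonneg_solution s x"
  shows "solution (\<lambda>i. K i \<bullet> s) x" "supersolution (\<lambda>i. K i \<bullet> s) x"
    "\<And>i. i \<in> I \<Longrightarrow> killed (\<lambda>i. K i \<bullet> s) x i = exit_rate i" "\<And>i. i \<in> I \<Longrightarrow> 0 < x i"
proof -
  show sol: "solution (\<lambda>i. K i \<bullet> s) x" and sup: "supersolution (\<lambda>i. K i \<bullet> s) x"
    using assms by (auto simp: nonneg_solution_def intro: solution_supersolution)
  show "killed (\<lambda>i. K i \<bullet> s) x i = exit_rate i" "0 < x i" if "i \<in> I" for i
    using sol that supersolution_positive[OF sup that] by (auto simp: solution_def)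
qed

text \<open>
  A bound at the initial states comes from \<open>\<alpha>\<^sub>i x\<^sub>i \<le> p\<^sub>0 + \<alpha> x = 1 / q \<le> 1\<close>.  It spreads along the
  transitions, since the equation at \<open>i\<close> bounds \<open>T i j x\<^sub>j\<close> by a multiple of \<open>x\<^sub>i\<close> for every successor
  \<open>j\<close> of \<open>i\<close>.
\<close>

lemma solutions_bounded:
  assumes large: "\<And>r. 0 \<le> r \<Longrightarrow> 1 \<le> q (r *\<^sub>R c)"
  shows "i \<in> I \<Longrightarrow> \<exists>C. \<forall>r\<in>{0..\<rho>}. \<forall>x. nonneg_solution (r *\<^sub>R c) x \<longrightarrow> x i \<le> C"
proof -
  define B where "B = {i \<in> I. \<exists>C. \<forall>r\<in>{0..\<rho>}. \<forall>x. nonneg_solution (r *\<^sub>R c) x \<longrightarrow> x i \<le> C}"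
  have "B = I"
  proof (rule accessible)
    show "B \<subseteq> I" by (auto simp: B_def)
  next
    fix i assume i: "i \<in> I" "0 < \<alpha> i"
    have "x i \<le> 1 / \<alpha> i" if r: "r \<in> {0..\<rho>}" and x: "nonneg_solution (r *\<^sub>R c) x" for r x
    proof -
      note sol = nonneg_solutionD[OF x]
      have "\<alpha> i * x i \<le> (\<Sum>i\<in>I. \<alpha> i * x i)"
        using i sol(4) initial_nonneg finite_states
        by (intro member_le_sum) (auto intro!: mult_nonneg_nonneg intro: less_imp_le)
      also have "\<dots> \<le> p\<^sub>0 + (\<Sum>i\<in>I. \<alpha> i * x i)" using defect_nonneg by simp
      also have "\<dots> = 1 / q (r *\<^sub>R c)"
        using transform_extends[OF sol(2,1)] large[of r] r by (simp add: field_simps)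
      also have "\<dots> \<le> 1" using large[of r] r by simp
      finally show ?thesis using i by (simp add: field_simps)
    qed
    then show "i \<in> B" using i unfolding B_def by blast
  next
    fix i j assume "i \<in> B" and j: "j \<in> I" and T: "0 < T i j"
    then obtain C where i: "i \<in> I" and C: "\<And>r x. r \<in> {0..\<rho>} \<Longrightarrow> nonneg_solution (r *\<^sub>R c) x \<Longrightarrow> x i \<le> C"
      unfolding B_def by blast
    show "j \<in> B"
    proof (cases "j = i")
      case True
      then show ?thesis using \<open>i \<in> B\<close> by simp
    next
      case False
      have "x j \<le> (\<rho> * \<bar>K i \<bullet> c\<bar> + \<bar>T i i\<bar>) * C / T i j"
        if r: "r \<in> {0..\<rho>}" and x: "nonneg_solution (r *\<^sub>R c) x" for r x
      proof -
        note sol = nonneg_solutionD[OF x]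
        have "T i j * x j \<le> (\<Sum>j\<in>I - {i}. T i j * x j)"
          using False i j sol(4) offdiag_nonneg finite_states
          by (intro member_le_sum) (auto intro!: mult_nonneg_nonneg intro: less_imp_le)
        also have "\<dots> = (K i \<bullet> (r *\<^sub>R c) - T i i) * x i - exit_rate i"
          using sol(3)[OF i] by (simp add: killed_diag[OF i])
        also have "\<dots> \<le> (\<rho> * \<bar>K i \<bullet> c\<bar> + \<bar>T i i\<bar>) * x i"
        proof -
          have "r * (K i \<bullet> c) \<le> r * \<bar>K i \<bullet> c\<bar>" using r by (intro mult_left_mono) auto
          also have "\<dots> \<le> \<rho> * \<bar>K i \<bullet> c\<bar>" using r by (intro mult_right_mono) auto
          finally have "K i \<bullet> (r *\<^sub>R c) - T i i \<le> \<rho> * \<bar>K i \<bullet> c\<bar> + \<bar>T i i\<bar>" by simp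
          then show ?thesis
            using mult_right_mono[OF _ less_imp_le[OF sol(4)[OF i]]] exit_rate_nonneg[OF i] by force
        qed
        also have "\<dots> \<le> (\<rho> * \<bar>K i \<bullet> c\<bar> + \<bar>T i i\<bar>) * C"
          using C[OF r x] r by (intro mult_left_mono) auto
        finally show ?thesis using T by (simp add: field_simps)
      qed
      then show ?thesis using j unfolding B_def by blast
    qed
  qed
  then show "i \<in> I \<Longrightarrow> ?thesis" by (auto simp: B_def)
qed

text \<open>
  The set of \<open>r \<ge> 0\<close> for which the system at \<open>r c\<close> has a nonnegative solution contains \<open>0\<close>.  It is open,
  because the solution is positive and depends continuously on \<open>r\<close> where it exists, and it is closed by
  the bounds above and compactness.  Hence it is the whole half-line.  But
  \<open>(r (K i \<bullet> c) - T i i) x\<^sub>i \<ge> 0\<close> with \<open>x\<^sub>i > 0\<close> for all \<open>r\<close> excludes \<open>K i \<bullet> c < 0\<close>.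
\<close>

lemma reward_nonneg_direction:
  assumes large: "\<And>r. 0 \<le> r \<Longrightarrow> 1 \<le> q (r *\<^sub>R c)" and i: "i \<in> I"
  shows "0 \<le> K i \<bullet> c"
proof -
  define H where "H = {r. \<exists>x. nonneg_solution (r *\<^sub>R c) x}"
  have "open H"
  proof (subst open_subopen, intro ballI)
    fix r assume "r \<in> H"
    then obtain x where x: "nonneg_solution (r *\<^sub>R c) x" by (auto simp: H_def)
    note sol = nonneg_solutionD[OF x]
    obtain D N where nonsingular: "\<And>\<kappa> w. supersolution \<kappa> w \<Longrightarrow> D \<kappa> \<noteq> 0"
      and solvable: "\<And>\<kappa>. D \<kappa> \<noteq> 0 \<Longrightarrow> \<exists>x. solution \<kappa> x"
      and cramer: "\<And>\<kappa> x i. solution \<kappa> x \<Longrightarrow> i \<in> I \<Longrightarrow> x i * D \<kappa> = N \<kappa> i"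
      and D_poly: "\<And>a b. \<exists>p. \<forall>u. D (\<lambda>i. a i + u * b i) = poly p u"
      and N_poly: "\<And>a b i. i \<in> I \<Longrightarrow> \<exists>p. \<forall>u. N (\<lambda>i. a i + u * b i) i = poly p u"
      by (rule obtain_cramer) blast
    define \<kappa> where "\<kappa> u = (\<lambda>i. K i \<bullet> (u *\<^sub>R c))" for u
    have \<kappa>: "\<kappa> u = (\<lambda>i. 0 + u * (K i \<bullet> c))" for u by (simp add: \<kappa>_def)
    obtain PD where PD: "\<And>u. D (\<kappa> u) = poly PD u"
      using D_poly[of "\<lambda>i. 0" "\<lambda>i. K i \<bullet> c"] by (auto simp: \<kappa>)
    have "\<forall>i\<in>I. \<exists>p. \<forall>u. N (\<kappa> u) i = poly p u"
      using N_poly[of _ "\<lambda>i. 0" "\<lambda>i. K i \<bullet> c"] by (auto simp: \<kappa>)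
    from bchoice[OF this] obtain PN where PN: "\<And>i u. i \<in> I \<Longrightarrow> N (\<kappa> u) i = poly (PN i) u"
      by blast
    have nz: "poly PD r \<noteq> 0"
      unfolding PD[symmetric] \<kappa>_def using nonsingular[OF sol(2)] .
    have lim: "((\<lambda>u. poly (PN j) u / poly PD u) \<longlongrightarrow> poly (PN j) r / poly PD r) (nhds r)" for j
    proof -
      have "isCont (\<lambda>u. poly (PN j) u / poly PD u) r"
        using nz by (intro continuous_intros) auto
      then show ?thesis
        using tendsto_at_iff_tendsto_nhds[of "\<lambda>u. poly (PN j) u / poly PD u" r]
        by (simp add: isCont_def)
    qed
    have "\<forall>\<^sub>F u in nhds r. \<forall>j\<in>I. 0 < poly (PN j) u / poly PD u"
    proof (rule eventually_ball_finite[OF finite_states], rule ballI)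
      fix j assume j: "j \<in> I"
      have "poly (PN j) r / poly PD r = x j"
        using cramer[OF sol(1) j] nz unfolding PN[OF j, symmetric] PD[symmetric] \<kappa>_def
        by (simp add: field_simps)
      then have "0 < poly (PN j) r / poly PD r" using sol(4)[OF j] by simp
      then show "\<forall>\<^sub>F u in nhds r. 0 < poly (PN j) u / poly PD u"
        using order_tendstoD(1)[OF lim] by blast
    qed
    moreover have "\<forall>\<^sub>F u in nhds r. poly PD u \<noteq> 0"
    proof -
      have "isCont (poly PD) r" by (intro continuous_intros)
      then have "(poly PD \<longlongrightarrow> poly PD r) (nhds r)"
        using tendsto_at_iff_tendsto_nhds[of "poly PD" r] by (simp add: isCont_def)
      then show ?thesis using nz by (rule tendsto_imp_eventually_ne)
    qed
    ultimately have "\<forall>\<^sub>F u in nhds r. u \<in> H"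
    proof eventually_elim
      case (elim u)
      then obtain y where y: "solution (\<kappa> u) y" using solvable[of "\<kappa> u"] by (auto simp: PD)
      have "0 \<le> y j" if "j \<in> I" for j
      proof -
        have "y j = poly (PN j) u / poly PD u"
          using cramer[OF y that] elim(2) by (simp add: PD PN[OF that] field_simps)
        then show ?thesis using elim(1) that by force
      qed
      then show ?case using y by (auto simp: H_def nonneg_solution_def \<kappa>_def)
    qed
    then show "\<exists>U. open U \<and> r \<in> U \<and> U \<subseteq> H" by (auto simp: eventually_nhds)
  qed
  have closed: "closed ({0..} \<inter> H)"
    unfolding closed_sequential_limits
  proof (intro allI impI, elim conjE)
    fix f l assume f: "\<forall>n. f n \<in> {0..} \<inter> H" and lim: "f \<longlonglongrightarrow> l"
    obtain \<rho> where \<rho>: "\<And>n. \<bar>f n\<bar> \<le> \<rho>"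
      using convergent_imp_bounded[OF lim] by (auto simp: bounded_iff)
    have f0: "f n \<in> {0..\<rho>}" for n using f \<rho>[of n] by auto
    from f have "\<forall>n. \<exists>x. nonneg_solution (f n *\<^sub>R c) x" by (auto simp: H_def)
    from choice[OF this] obtain X where X: "\<And>n. nonneg_solution (f n *\<^sub>R c) (X n)" by blast
    obtain C where "\<And>i r x. i \<in> I \<Longrightarrow> r \<in> {0..\<rho>} \<Longrightarrow> nonneg_solution (r *\<^sub>R c) x \<Longrightarrow> x i \<le> C i"
      using solutions_bounded[OF large, of _ \<rho>] by metis
    then have "\<bar>X n i\<bar> \<le> C i" if "i \<in> I" for n i
      using X f0 that nonneg_solutionD(4)[OF X that, of n] by force
    then obtain \<sigma> L where \<sigma>: "strict_mono \<sigma>" and L: "\<And>i. i \<in> I \<Longrightarrow> (\<lambda>n. X (\<sigma> n) i) \<longlonglongrightarrow> L i"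
      using bounded_family_subsequence[OF finite_states, of X C] by metis
    have flim: "(\<lambda>n. f (\<sigma> n)) \<longlonglongrightarrow> l"
      using LIMSEQ_subseq_LIMSEQ[OF lim \<sigma>] by (simp add: o_def)
    have "killed (\<lambda>i. K i \<bullet> (l *\<^sub>R c)) L i = exit_rate i" if i: "i \<in> I" for i
    proof (rule LIMSEQ_unique)
      have "(\<lambda>n. K i \<bullet> (f (\<sigma> n) *\<^sub>R c)) \<longlonglongrightarrow> K i \<bullet> (l *\<^sub>R c)"
        by (intro tendsto_inner tendsto_scaleR tendsto_const flim)
      then show "(\<lambda>n. killed (\<lambda>i. K i \<bullet> (f (\<sigma> n) *\<^sub>R c)) (X (\<sigma> n)) i)
          \<longlonglongrightarrow> killed (\<lambda>i. K i \<bullet> (l *\<^sub>R c)) L i"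
        unfolding killed_def by (intro tendsto_diff tendsto_mult tendsto_sum tendsto_const L i)
      show "(\<lambda>n. killed (\<lambda>i. K i \<bullet> (f (\<sigma> n) *\<^sub>R c)) (X (\<sigma> n)) i) \<longlonglongrightarrow> exit_rate i"
        by (simp only: nonneg_solutionD(3)[OF X i] tendsto_const)
    qed
    moreover have "0 \<le> L i" if "i \<in> I" for i
      using LIMSEQ_le_const[OF L[OF that], of 0] nonneg_solutionD(4)[OF X that] less_imp_le by blast
    ultimately have "l \<in> H" by (auto simp: H_def nonneg_solution_def solution_def)
    moreover have "0 \<le> l" using LIMSEQ_le_const[OF lim, of 0] f by auto
    ultimately show "l \<in> {0..} \<inter> H" by simp
  qed
  have "0 \<in> H"
    by (auto simp: H_def nonneg_solution_def solution_def killed_one intro!: exI[of _ "\<lambda>_. 1"])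
  moreover have "openin (top_of_set {0..}) ({0..} \<inter> H)"
    using \<open>open H\<close> by (rule openin_open_Int)
  moreover have "closedin (top_of_set {0..}) ({0..} \<inter> H)"
    using closed by (intro closed_subset) auto
  moreover have "connected {0::real..}" by (rule connected_Ici)
  ultimately have "{0..} \<inter> H = {0..}" unfolding connected_clopen by fastforce
  then have H: "r \<in> H" if "0 \<le> r" for r using that by auto
  have bound: "T i i \<le> r * (K i \<bullet> c)" if nonneg: "0 \<le> r" for r
  proof -
    obtain x where x: "nonneg_solution (r *\<^sub>R c) x" using H[OF nonneg] by (auto simp: H_def)
    note sol = nonneg_solutionD[OF x]
    have "0 \<le> exit_rate i + (\<Sum>j\<in>I - {i}. T i j * x j)"
      using exit_rate_nonneg[OF i] sol(4) offdiag_nonneg[OF i]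
      by (auto intro!: add_nonneg_nonneg sum_nonneg mult_nonneg_nonneg intro: less_imp_le)
    also have "\<dots> = (K i \<bullet> (r *\<^sub>R c) - T i i) * x i"
      using sol(3)[OF i] by (simp add: killed_diag[OF i])
    finally show ?thesis
      using sol(4)[OF i] by (simp add: zero_le_mult_iff)
  qed
  show ?thesis
  proof (rule ccontr)
    assume neg: "\<not> 0 \<le> K i \<bullet> c"
    \<comment> \<open>Any \<open>r\<close> greater than \<open>|T i i| / |K i \<bullet> c|\<close> violates the bound.\<close>
    have "T i i \<le> (1 + \<bar>T i i\<bar>) / - (K i \<bullet> c) * (K i \<bullet> c)"
      using neg by (intro bound divide_nonneg_pos) auto
    also have "\<dots> = - (1 + \<bar>T i i\<bar>)" using neg by simp
    finally show False by linarith
  qed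
qed

end

section \<open>Necessary conditions for the class MPH*\<close>

text \<open>
  From a set of states without exit and without outgoing transitions the chain is never absorbed, so
  transience forbids such a set.
\<close>

lemma closed_states_absorbing_system:
  assumes T: "transient_subgenerator m T" and R: "R \<subseteq> {..<m}"
    and closed: "\<And>i j. i \<in> R \<Longrightarrow> j < m \<Longrightarrow> j \<notin> R \<Longrightarrow> T $$ (i, j) = 0"
  shows "absorbing_system R (\<lambda>i j. T $$ (i, j))"
proof
  have sub: "subgenerator m T" and lim: "\<And>i. i < m \<Longrightarrow> (\<lambda>k. unabsorbed m T k i) \<longlonglongrightarrow> 0"
    using T by (auto simp: transient_subgenerator_def)
  show "finite R" using R by (rule finite_subset) simp
  show offdiag: "0 \<le> T $$ (i, j)" if "i \<in> R" "j \<in> R" "i \<noteq> j" for i j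
    using sub that subsetD[OF R] unfolding subgenerator_def by blast
  have row: "(\<Sum>j\<in>R. T $$ (i, j)) = (\<Sum>j<m. T $$ (i, j))" if "i \<in> R" for i
    using R closed[OF that] by (intro sum.mono_neutral_left) auto
  show nonpos: "(\<Sum>j\<in>R. T $$ (i, j)) \<le> 0" if "i \<in> R" for i
    unfolding row[OF that] using sub subsetD[OF R that] by (simp add: subgenerator_def)
  show "\<exists>i\<in>S. (\<Sum>j\<in>R. T $$ (i, j)) < 0 \<or> (\<exists>j\<in>R - S. 0 < T $$ (i, j))"
    if S: "S \<subseteq> R" "S \<noteq> {}" for S
  proof (rule ccontr)
    assume trapped: "\<not> ?thesis"
    have zero_row: "(\<Sum>j\<in>R. T $$ (i, j)) = 0" if "i \<in> S" for i
    proof -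
      have "\<not> (\<Sum>j\<in>R. T $$ (i, j)) < 0" using trapped that by blast
      moreover have "(\<Sum>j\<in>R. T $$ (i, j)) \<le> 0" using nonpos S(1) that by blast
      ultimately show ?thesis by linarith
    qed
    have inside: "T $$ (i, j) = 0" if "i \<in> S" "j < m" "j \<notin> S" for i j
    proof (cases "j \<in> R")
      case True
      have "\<not> 0 < T $$ (i, j)" using trapped that True by blast
      moreover have "0 \<le> T $$ (i, j)" using offdiag[of i j] True S(1) that by blast
      ultimately show ?thesis by linarith
    next
      case False
      then show ?thesis using closed S(1) that by blast
    qed
    have "unabsorbed m T k i = 1" if "i \<in> S" for k i
      using that
    proof (induction k arbitrary: i)
      case (Suc k)
      have im: "i < m" using Suc.prems S(1) R by auto
      have Tii: "T $$ (i, i) < 0" using im sub by (simp add: subgenerator_def)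
      have "T $$ (i, j) / (- T $$ (i, i)) * unabsorbed m T k j = T $$ (i, j) / (- T $$ (i, i))"
        if "j \<in> {..<m} - {i}" for j
        using Suc inside[OF Suc.prems] that by (cases "j \<in> S") auto
      then have "unabsorbed m T (Suc k) i = (\<Sum>j\<in>{..<m} - {i}. T $$ (i, j) / (- T $$ (i, i)))"
        unfolding unabsorbed.simps by (rule sum.cong[OF refl])
      also have "\<dots> = (\<Sum>j\<in>{..<m} - {i}. T $$ (i, j)) / (- T $$ (i, i))"
        by (simp only: sum_divide_distrib)
      also have "(\<Sum>j\<in>{..<m} - {i}. T $$ (i, j)) = - T $$ (i, i)"
      proof -
        have "(\<Sum>j<m. T $$ (i, j)) = 0"
          using zero_row[OF Suc.prems] row[of i] Suc.prems S(1) by auto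
        then show ?thesis using im by (simp add: sum.remove[of "{..<m}" i])
      qed
      finally show ?case using Tii by simp
    qed simp
    moreover obtain i where "i \<in> S" using S by blast
    moreover from this have "i < m" using S R by auto
    ultimately have "(\<lambda>k. 1 :: real) \<longlonglongrightarrow> 0" using lim[of i] by simp
    then show False by (simp add: LIMSEQ_const_iff)
  qed
qed

text \<open>
  The constant \<open>1\<close> is a supersolution for nonnegative rewards, so the matrix is invertible and the
  default value hidden in the inverse of the definition does not occur.
\<close>

lemma mph_transform_solution:
  assumes T: "transient_subgenerator m T" and \<alpha>: "\<alpha> \<in> carrier_vec m"
    and nonneg: "\<And>i. i < m \<Longrightarrow> 0 \<le> K i \<bullet> s"
  obtains y where "absorbing_system.solution {..<m} (\<lambda>i j. T $$ (i, j)) (\<lambda>i. K i \<bullet> s) y"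
    "mph_transform m \<alpha> T K s = (1 - (\<Sum>i<m. vec_index \<alpha> i)) + (\<Sum>i<m. vec_index \<alpha> i * y i)"
proof -
  interpret full: absorbing_system "{..<m}" "\<lambda>i j. T $$ (i, j)"
    by (rule closed_states_absorbing_system[OF T]) auto
  have carr: "T \<in> carrier_mat m m" using T by (simp add: transient_subgenerator_def subgenerator_def)
  define A where "A = - T + mat_diag m (\<lambda>i. K i \<bullet> s)"
  define one :: "real Matrix.vec" where "one = Matrix.vec m (\<lambda>_. 1)"
  define t where "t = - (T *\<^sub>v one)"
  have A: "A \<in> carrier_mat m m" using carr by (simp add: A_def)
  have t: "t \<in> carrier_vec m" using carr by (simp add: t_def one_def)
  have t_index: "vec_index t i = full.exit_rate i" if "i < m" for i
    unfolding full.exit_rate_def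
    using that carr by (simp add: t_def one_def scalar_prod_def lessThan_atLeast0)
  have mv: "vec_index (A *\<^sub>v v) i = full.killed (\<lambda>i. K i \<bullet> s) (vec_index v) i"
    if "v \<in> carrier_vec m" "i < m" for v i
  proof -
    have "vec_index (A *\<^sub>v v) i = (\<Sum>j<m. A $$ (i, j) * vec_index v j)"
      using A that by (simp add: scalar_prod_def lessThan_atLeast0)
    also have "\<dots> = (\<Sum>j<m. (if i = j then K i \<bullet> s * vec_index v i else 0) - T $$ (i, j) * vec_index v j)"
      using carr that by (intro sum.cong) (auto simp: A_def mat_diag_def algebra_simps)
    also have "\<dots> = full.killed (\<lambda>i. K i \<bullet> s) (vec_index v) i"
      using that by (simp add: sum_subtractf full.killed_def)
    finally show ?thesis .
  qed
  have sup: "full.supersolution (\<lambda>i. K i \<bullet> s) (\<lambda>_. 1)"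
    by (rule full.one_supersolution) (use nonneg in auto)
  have "Determinant.det A \<noteq> 0"
  proof
    assume "Determinant.det A = 0"
    then obtain v where v: "v \<in> carrier_vec m" "v \<noteq> 0\<^sub>v m" "A *\<^sub>v v = 0\<^sub>v m"
      using det_0_iff_vec_prod_zero_field[OF A] by auto
    have "full.killed (\<lambda>i. K i \<bullet> s) (vec_index v) i = 0" if "i \<in> {..<m}" for i
      using mv[OF v(1), of i] v(3) that by simp
    then have "vec_index v i = 0" if "i < m" for i
      using full.killed_injective[OF sup] that by blast
    then have "v = 0\<^sub>v m" using v(1) by (intro eq_vecI) auto
    then show False using v(2) by simp
  qed
  then have unit: "A \<in> Units (ring_mat TYPE(real) m ())" by (rule det_non_zero_imp_unit[OF A])
  obtain B where B: "mat_inverse A = Some B"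
    using mat_inverse(1)[OF A, of "()"] unit by (cases "mat_inverse A") auto
  from mat_inverse(2)[OF A B] have inv: "A * B = 1\<^sub>m m" "B \<in> carrier_mat m m" by auto
  define v where "v = B *\<^sub>v t"
  have v: "v \<in> carrier_vec m" using inv t by (simp add: v_def)
  have "A *\<^sub>v v = t"
    unfolding v_def using inv t A by (metis assoc_mult_mat_vec one_mult_mat_vec)
  then have "full.solution (\<lambda>i. K i \<bullet> s) (vec_index v)"
    using mv[OF v] t_index by (auto simp: full.solution_def)
  moreover have "mph_transform m \<alpha> T K s
      = (1 - (\<Sum>i<m. vec_index \<alpha> i)) + (\<Sum>i<m. vec_index \<alpha> i * vec_index v i)"
    using v B \<alpha> unfolding mph_transform_def Let_def
    by (simp add: A_def[symmetric] one_def[symmetric] t_def[symmetric] v_def[symmetric])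
      (simp add: scalar_prod_def one_def lessThan_atLeast0)
  ultimately show thesis by (rule that)
qed

text \<open>
  \<open>\<K>\<close> consists of the reward vectors of the reachable phases, so it generates the same closed convex
  cone as the support of \<open>Y\<close>.  The two conclusions bound the dual of this cone from inside and from outside in
  terms of \<open>q\<close> alone.
\<close>

theorem mph_star_reward_cone:
  fixes Y :: "'w \<Rightarrow> real ^ 'n" and q :: "real ^ 'n \<Rightarrow> real"
  assumes Y: "Y \<in> mph_star M"
    and transform: "\<And>s. (\<And>j. 0 \<le> s $ j) \<Longrightarrow> (\<integral>\<omega>. exp (- (s \<bullet> Y \<omega>)) \<partial>M) * q s = 1"
    and polynomial: "\<And>a b. \<exists>p. \<forall>u. q (a + u *\<^sub>R b) = poly p u"
  obtains \<K> where "finite \<K>"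
    "\<And>k c. k \<in> \<K> \<Longrightarrow> (\<And>r. 0 \<le> r \<Longrightarrow> 1 \<le> q (r *\<^sub>R c)) \<Longrightarrow> 0 \<le> k \<bullet> c"
    "\<And>s. (\<And>k. k \<in> \<K> \<Longrightarrow> 0 \<le> k \<bullet> s) \<Longrightarrow> q s \<noteq> 0"
proof -
  obtain m \<alpha> T K where \<alpha>: "\<alpha> \<in> carrier_vec m" "\<And>i. i < m \<Longrightarrow> 0 \<le> vec_index \<alpha> i"
      "(\<Sum>i<m. vec_index \<alpha> i) \<le> 1"
    and T: "transient_subgenerator m T" and K: "\<And>i j. i < m \<Longrightarrow> 0 \<le> K i $ j"
    and eq: "\<And>s. (\<And>j. 0 \<le> s $ j) \<Longrightarrow> (\<integral>\<omega>. exp (- (s \<bullet> Y \<omega>)) \<partial>M) = mph_transform m \<alpha> T K s"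
    using Y unfolding mph_star_def by blast
  define accessible where "accessible B \<longleftrightarrow> B \<subseteq> {..<m} \<and> (\<forall>i<m. 0 < vec_index \<alpha> i \<longrightarrow> i \<in> B) \<and>
    (\<forall>i\<in>B. \<forall>j<m. 0 < T $$ (i, j) \<longrightarrow> j \<in> B)" for B
  \<comment> \<open>Only reachable phases enter the transform; the rewards of the others are unconstrained.\<close>
  define R where "R = \<Inter> {B. accessible B}"
  have "accessible {..<m}" by (simp add: accessible_def)
  then have R: "R \<subseteq> {..<m}" by (auto simp: R_def)
  have start: "i \<in> R" if "i < m" "0 < vec_index \<alpha> i" for i
    using that by (auto simp: R_def accessible_def)
  have step: "j \<in> R" if "i \<in> R" "j < m" "0 < T $$ (i, j)" for i j
    using that unfolding R_def accessible_def by blast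
  have sub: "subgenerator m T" using T by (simp add: transient_subgenerator_def)
  have closed: "T $$ (i, j) = 0" if "i \<in> R" "j < m" "j \<notin> R" for i j
  proof -
    have "i < m" "i \<noteq> j" using that R by auto
    then have "0 \<le> T $$ (i, j)" using sub that by (auto simp: subgenerator_def)
    then show ?thesis using step[OF that(1,2)] that(3) by force
  qed
  interpret full: absorbing_system "{..<m}" "\<lambda>i j. T $$ (i, j)"
    by (rule closed_states_absorbing_system[OF T]) auto
  interpret absorbing_system R "\<lambda>i j. T $$ (i, j)"
    by (rule closed_states_absorbing_system[OF T R closed])
  have restrict: "(\<Sum>j<m. T $$ (i, j) * v j) = (\<Sum>j\<in>R. T $$ (i, j) * v j)" if "i \<in> R" for i v
    using R closed[OF that] by (intro sum.mono_neutral_right) auto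
  interpret rewarded_system R "\<lambda>i j. T $$ (i, j)" "vec_index \<alpha>" "1 - (\<Sum>i<m. vec_index \<alpha> i)" K q
  proof
    show "0 \<le> vec_index \<alpha> i" "0 \<le> K i $ j" if "i \<in> R" for i j using \<alpha>(2) K R that by auto
    show "0 \<le> 1 - (\<Sum>i<m. vec_index \<alpha> i)" using \<alpha>(3) by simp
    show "\<exists>p. \<forall>u. q (a + u *\<^sub>R b) = poly p u" for a b by (rule polynomial)
  next
    fix B assume B: "B \<subseteq> R" and initial: "\<And>i. i \<in> R \<Longrightarrow> 0 < vec_index \<alpha> i \<Longrightarrow> i \<in> B"
      and successor: "\<And>i j. i \<in> B \<Longrightarrow> j \<in> R \<Longrightarrow> 0 < T $$ (i, j) \<Longrightarrow> j \<in> B"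
    have "accessible B"
      unfolding accessible_def using B R initial successor start step by (meson subset_iff)
    then show "B = R" using B by (auto simp: R_def)
  next
    fix s :: "real ^ 'n" and x
    assume s: "\<And>j. 0 \<le> s $ j" and x: "solution (\<lambda>i. K i \<bullet> s) x"
    have nonneg: "0 \<le> K i \<bullet> s" if "i < m" for i
      unfolding inner_vec_def using K[OF that] s by (auto intro!: sum_nonneg)
    obtain y where y: "full.solution (\<lambda>i. K i \<bullet> s) y"
      and tr: "mph_transform m \<alpha> T K s = (1 - (\<Sum>i<m. vec_index \<alpha> i)) + (\<Sum>i<m. vec_index \<alpha> i * y i)"
      using mph_transform_solution[where K = K and s = s, OF T \<alpha>(1) nonneg] by blast
    have sup: "supersolution (\<lambda>i. K i \<bullet> s) (\<lambda>_. 1)"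
      by (rule one_supersolution) (use nonneg R in auto)
    have "killed (\<lambda>i. K i \<bullet> s) y i = exit_rate i" if "i \<in> R" for i
    proof -
      have "full.killed (\<lambda>i. K i \<bullet> s) y i = full.exit_rate i"
        using y subsetD[OF R that] by (simp add: full.solution_def)
      then show ?thesis
        using restrict[OF that, of y] restrict[OF that, of "\<lambda>_. 1"]
        by (simp add: full.killed_def full.exit_rate_def killed_def exit_rate_def)
    qed
    then have "killed (\<lambda>i. K i \<bullet> s) (\<lambda>j. 1 * y j + (- 1) * x j) i = 0" if "i \<in> R" for i
      unfolding killed_linear using x that by (simp add: solution_def)
    then have "y i = x i" if "i \<in> R" for i
      using killed_injective[OF sup, of "\<lambda>j. 1 * y j + (- 1) * x j" i] that by simp
    moreover have "vec_index \<alpha> i = 0" if "i < m" "i \<notin> R" for i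
      using start[of i] \<alpha>(2)[of i] that by force
    then have "(\<Sum>i<m. vec_index \<alpha> i * y i) = (\<Sum>i\<in>R. vec_index \<alpha> i * y i)"
      using R by (intro sum.mono_neutral_right) auto
    ultimately have "(\<Sum>i<m. vec_index \<alpha> i * y i) = (\<Sum>i\<in>R. vec_index \<alpha> i * x i)" by simp
    then show "(1 - (\<Sum>i<m. vec_index \<alpha> i) + (\<Sum>i\<in>R. vec_index \<alpha> i * x i)) * q s = 1"
      using transform[OF s] eq[OF s] tr by simp
  qed
  show thesis
  proof (rule that[of "K ` R"])
    show "finite (K ` R)" using finite_states by simp
    show "0 \<le> k \<bullet> c" if "k \<in> K ` R" "\<And>r. 0 \<le> r \<Longrightarrow> 1 \<le> q (r *\<^sub>R c)" for k c
      using reward_nonneg_direction[OF that(2)] that(1) by blast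
    show "q s \<noteq> 0" if "\<And>k. k \<in> K ` R \<Longrightarrow> 0 \<le> k \<bullet> s" for s
      using nonvanishing that by blast
  qed
qed

section \<open>Laplace transform of the Wishart distribution\<close>

text \<open>
  Completing the square gives a multiple of the normal density with mean \<open>-b / a\<close> and variance \<open>1 / a\<close>.
\<close>

lemma nn_integral_gaussian_line:
  fixes a b :: real
  assumes "0 < a"
  shows "(\<integral>\<^sup>+x. ennreal (exp (- (a * x\<^sup>2 + 2 * b * x) / 2)) \<partial>lborel)
    = ennreal (sqrt (2 * pi / a) * exp (b\<^sup>2 / (2 * a)))"
proof -
  define \<sigma> where "\<sigma> = 1 / sqrt a"
  have \<sigma>: "0 < \<sigma>" "\<sigma>\<^sup>2 = 1 / a" using assms by (auto simp: \<sigma>_def power_divide)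
  define C where "C = sqrt (2 * pi / a) * exp (b\<^sup>2 / (2 * a))"
  have "exp (- (a * x\<^sup>2 + 2 * b * x) / 2) = C * normal_density (- b / a) \<sigma> x" for x
  proof -
    have "- (a * x\<^sup>2 + 2 * b * x) / 2 = b\<^sup>2 / (2 * a) + - (x - (- b / a))\<^sup>2 / (2 * \<sigma>\<^sup>2)"
      using assms unfolding \<sigma>(2) by (simp add: power2_eq_square field_simps)
    then have "exp (- (a * x\<^sup>2 + 2 * b * x) / 2)
        = exp (b\<^sup>2 / (2 * a)) * exp (- (x - (- b / a))\<^sup>2 / (2 * \<sigma>\<^sup>2))"
      by (simp only: exp_add)
    moreover have "sqrt (2 * pi / a) * (1 / sqrt (2 * pi * \<sigma>\<^sup>2)) = 1"
      using assms by (simp add: \<sigma>(2))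
    moreover have "C * normal_density (- b / a) \<sigma> x
        = (sqrt (2 * pi / a) * (1 / sqrt (2 * pi * \<sigma>\<^sup>2)))
          * (exp (b\<^sup>2 / (2 * a)) * exp (- (x - (- b / a))\<^sup>2 / (2 * \<sigma>\<^sup>2)))"
      unfolding C_def normal_density_def by (simp only: mult_ac)
    ultimately show ?thesis by (simp only: mult_1)
  qed
  moreover have "0 \<le> C" using assms by (simp add: C_def)
  moreover have "(\<integral>\<^sup>+x. ennreal (normal_density (- b / a) \<sigma> x) \<partial>lborel) = 1"
    using prob_space.emeasure_space_1[OF prob_space_normal_density[OF \<sigma>(1)]]
    by (simp add: emeasure_density)
  ultimately show ?thesis
    by (simp add: ennreal_mult nn_integral_cmult C_def[symmetric])
qed

lemma nn_integral_lborel_vec2: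
  fixes f :: "real ^ 2 \<Rightarrow> ennreal"
  assumes [measurable]: "f \<in> borel_measurable borel"
  shows "(\<integral>\<^sup>+v. f v \<partial>lborel) = (\<integral>\<^sup>+y. \<integral>\<^sup>+x. f (vector [x, y]) \<partial>lborel \<partial>lborel)"
proof -
  interpret product_sigma_finite "\<lambda>_. lborel :: real measure"
    by unfold_locales
  let ?e = "\<lambda>i. axis i 1 :: real ^ 2"
  have Basis: "(Basis :: (real ^ 2) set) = insert (?e 1) {?e 2}"
    by (auto simp: Basis_vec_def UNIV_2)
  have eq: "vector [x, y] = x *\<^sub>R ?e 1 + y *\<^sub>R ?e 2" for x y
    by (simp add: Finite_Cartesian_Product.vec_eq_iff forall_2 axis_def)
  have ne: "?e 1 \<noteq> ?e 2" by (simp add: axis_eq_axis)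
  have "(\<integral>\<^sup>+v. f v \<partial>lborel)
      = (\<integral>\<^sup>+g. f (\<Sum>b\<in>Basis. g b *\<^sub>R b) \<partial>Pi\<^sub>M Basis (\<lambda>_. lborel))"
    by (subst lborel_eq) (simp add: nn_integral_distr)
  also have "\<dots> = (\<integral>\<^sup>+g. \<integral>\<^sup>+x. f (\<Sum>b\<in>Basis. (g(?e 1 := x)) b *\<^sub>R b) \<partial>lborel \<partial>Pi\<^sub>M {?e 2} (\<lambda>_. lborel))"
    unfolding Basis using ne by (subst product_nn_integral_insert) auto
  also have "\<dots> = (\<integral>\<^sup>+g. \<integral>\<^sup>+x. f (vector [x, g (?e 2)]) \<partial>lborel \<partial>Pi\<^sub>M {?e 2} (\<lambda>_. lborel))"
  proof -
    have "(\<Sum>b\<in>Basis. (g(?e 1 := x)) b *\<^sub>R b) = x *\<^sub>R ?e 1 + g (?e 2) *\<^sub>R ?e 2" for g x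
      unfolding Basis using ne by simp
    then show ?thesis by (simp add: eq)
  qed
  also have "\<dots> = (\<integral>\<^sup>+y. \<integral>\<^sup>+x. f (vector [x, y]) \<partial>lborel \<partial>lborel)"
  proof (rule product_nn_integral_singleton[where f = "\<lambda>y. \<integral>\<^sup>+x. f (vector [x, y]) \<partial>lborel"])
    show "(\<lambda>y. \<integral>\<^sup>+x. f (vector [x, y]) \<partial>lborel) \<in> borel_measurable lborel"
      unfolding eq by measurable
  qed
  finally show ?thesis .
qed

text \<open>
  With the Gaussian weight included the exponent is the quadratic form of \<open>I + B\<close>, integrated one
  coordinate after the other; the second integration sees the Schur complement.
\<close>

lemma std_gaussian_transform:
  assumes a: "0 < 1 + b11" and d: "0 < (1 + b11) * (1 + b22) - b12\<^sup>2"
  shows "(\<integral>\<^sup>+v. ennreal (exp (- (b11 * (v $ 1)\<^sup>2 + 2 * b12 * v $ 1 * v $ 2 + b22 * (v $ 2)\<^sup>2) / 2))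
      \<partial>(std_gaussian :: (real ^ 2) measure))
    = ennreal (1 / sqrt ((1 + b11) * (1 + b22) - b12\<^sup>2))"
proof -
  let ?a = "1 + b11" and ?b = "b12" and ?d = "1 + b22"
  let ?c = "?d - ?b\<^sup>2 / ?a"
  have c: "0 < ?c" using a d by (simp add: field_simps)
  have sq: "((2::real) * pi) = sqrt (2 * pi) * sqrt (2 * pi)" by simp
  have "(\<integral>\<^sup>+v. ennreal (exp (- (b11 * (v $ 1)\<^sup>2 + 2 * b12 * v $ 1 * v $ 2 + b22 * (v $ 2)\<^sup>2) / 2))
      \<partial>(std_gaussian :: (real ^ 2) measure))
    = (\<integral>\<^sup>+v. ennreal (std_normal_density (v $ 1) * std_normal_density (v $ 2)) *
        ennreal (exp (- (b11 * (v $ 1)\<^sup>2 + 2 * b12 * v $ 1 * v $ 2 + b22 * (v $ 2)\<^sup>2) / 2))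
      \<partial>(lborel :: (real ^ 2) measure))"
    unfolding std_gaussian_def by (subst nn_integral_density) (auto simp: UNIV_2)
  also have "\<dots> = (\<integral>\<^sup>+v. ennreal (1 / (2 * pi) * exp (- (?d * (v $ 2)\<^sup>2) / 2)
        * exp (- (?a * (v $ 1)\<^sup>2 + 2 * (?b * v $ 2) * v $ 1) / 2)) \<partial>(lborel :: (real ^ 2) measure))"
  proof (intro nn_integral_cong)
    fix v :: "real ^ 2"
    have "std_normal_density (v $ 1) * std_normal_density (v $ 2) *
        exp (- (b11 * (v $ 1)\<^sup>2 + 2 * b12 * v $ 1 * v $ 2 + b22 * (v $ 2)\<^sup>2) / 2)
      = 1 / (2 * pi) * exp (- (?d * (v $ 2)\<^sup>2) / 2 + - (?a * (v $ 1)\<^sup>2 + 2 * (?b * v $ 2) * v $ 1) / 2)"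
      unfolding std_normal_density_def
      by (subst (3) sq) (simp add: exp_add[symmetric] field_simps del: real_sqrt_mult_self)
    then show "ennreal (std_normal_density (v $ 1) * std_normal_density (v $ 2)) *
        ennreal (exp (- (b11 * (v $ 1)\<^sup>2 + 2 * b12 * v $ 1 * v $ 2 + b22 * (v $ 2)\<^sup>2) / 2))
      = ennreal (1 / (2 * pi) * exp (- (?d * (v $ 2)\<^sup>2) / 2)
        * exp (- (?a * (v $ 1)\<^sup>2 + 2 * (?b * v $ 2) * v $ 1) / 2))"
      by (simp only: ennreal_mult[symmetric] exp_add mult.assoc normal_density_nonneg exp_ge_zero mult_nonneg_nonneg)
  qed
  also have "\<dots> = (\<integral>\<^sup>+y. \<integral>\<^sup>+x. ennreal (1 / (2 * pi) * exp (- (?d * y\<^sup>2) / 2)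
        * exp (- (?a * x\<^sup>2 + 2 * (?b * y) * x) / 2)) \<partial>lborel \<partial>lborel)"
    by (subst nn_integral_lborel_vec2) auto
  also have "\<dots> = (\<integral>\<^sup>+y. ennreal (1 / (2 * pi) * exp (- (?d * y\<^sup>2) / 2))
        * ennreal (sqrt (2 * pi / ?a) * exp ((?b * y)\<^sup>2 / (2 * ?a))) \<partial>lborel)"
  proof (intro nn_integral_cong)
    fix y :: real
    have "(\<integral>\<^sup>+x. ennreal (1 / (2 * pi) * exp (- (?d * y\<^sup>2) / 2)
          * exp (- (?a * x\<^sup>2 + 2 * (?b * y) * x) / 2)) \<partial>lborel)
        = (\<integral>\<^sup>+x. ennreal (1 / (2 * pi) * exp (- (?d * y\<^sup>2) / 2))
          * ennreal (exp (- (?a * x\<^sup>2 + 2 * (?b * y) * x) / 2)) \<partial>lborel)"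
      by (intro nn_integral_cong ennreal_mult) auto
    also have "\<dots> = ennreal (1 / (2 * pi) * exp (- (?d * y\<^sup>2) / 2))
        * ennreal (sqrt (2 * pi / ?a) * exp ((?b * y)\<^sup>2 / (2 * ?a)))"
      by (subst nn_integral_cmult) (simp, simp only: nn_integral_gaussian_line[OF a])
    finally show "(\<integral>\<^sup>+x. ennreal (1 / (2 * pi) * exp (- (?d * y\<^sup>2) / 2)
          * exp (- (?a * x\<^sup>2 + 2 * (?b * y) * x) / 2)) \<partial>lborel)
        = ennreal (1 / (2 * pi) * exp (- (?d * y\<^sup>2) / 2))
        * ennreal (sqrt (2 * pi / ?a) * exp ((?b * y)\<^sup>2 / (2 * ?a)))" .
  qed
  also have "\<dots> = (\<integral>\<^sup>+y. ennreal (1 / (2 * pi) * sqrt (2 * pi / ?a))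
        * ennreal (exp (- (?c * y\<^sup>2 + 2 * 0 * y) / 2)) \<partial>lborel)"
  proof (intro nn_integral_cong)
    fix y :: real
    have "- (?d * y\<^sup>2) / 2 + (?b * y)\<^sup>2 / (2 * ?a) = - (?c * y\<^sup>2 + 2 * 0 * y) / 2"
      using a by (simp add: field_simps power2_eq_square)
    then have "exp (- (?d * y\<^sup>2) / 2) * exp ((?b * y)\<^sup>2 / (2 * ?a)) = exp (- (?c * y\<^sup>2 + 2 * 0 * y) / 2)"
      by (metis exp_add)
    then have "1 / (2 * pi) * exp (- (?d * y\<^sup>2) / 2) * (sqrt (2 * pi / ?a) * exp ((?b * y)\<^sup>2 / (2 * ?a)))
      = 1 / (2 * pi) * sqrt (2 * pi / ?a) * exp (- (?c * y\<^sup>2 + 2 * 0 * y) / 2)"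
      by (simp add: mult_ac)
    then show "ennreal (1 / (2 * pi) * exp (- (?d * y\<^sup>2) / 2))
        * ennreal (sqrt (2 * pi / ?a) * exp ((?b * y)\<^sup>2 / (2 * ?a)))
      = ennreal (1 / (2 * pi) * sqrt (2 * pi / ?a)) * ennreal (exp (- (?c * y\<^sup>2 + 2 * 0 * y) / 2))"
      using a by (simp add: ennreal_mult[symmetric])
  qed
  also have "\<dots> = ennreal (1 / (2 * pi) * sqrt (2 * pi / ?a)) * ennreal (sqrt (2 * pi / ?c))"
    by (subst nn_integral_cmult, simp) (subst nn_integral_gaussian_line[OF c], simp)
  also have "\<dots> = ennreal (1 / (2 * pi) * sqrt (2 * pi / ?a) * sqrt (2 * pi / ?c))"
    using a c by (intro ennreal_mult[symmetric]) auto
  also have "1 / (2 * pi) * sqrt (2 * pi / ?a) * sqrt (2 * pi / ?c)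
      = 1 / sqrt ((1 + b11) * (1 + b22) - b12\<^sup>2)"
  proof -
    have ac: "?a * ?c = (1 + b11) * (1 + b22) - b12\<^sup>2" using a by (simp add: field_simps)
    have "sqrt (2 * pi / ?a) * sqrt (2 * pi / ?c) = sqrt ((2 * pi)\<^sup>2 / (?a * ?c))"
      by (simp only: real_sqrt_mult[symmetric] times_divide_times_eq power2_eq_square)
    also have "\<dots> = 2 * pi / sqrt (?a * ?c)"
      by (simp only: real_sqrt_divide real_sqrt_abs) simp
    finally have "1 / (2 * pi) * sqrt (2 * pi / ?a) * sqrt (2 * pi / ?c) = 1 / (2 * pi) * (2 * pi / sqrt (?a * ?c))"
      by (simp only: mult.assoc)
    also have "\<dots> = 1 / sqrt (?a * ?c)" by simp
    finally show ?thesis by (simp only: ac)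
  qed
  finally show ?thesis .
qed

text \<open>
  The total mass is the transform at zero.
\<close>

lemma prob_space_std_gaussian: "prob_space (std_gaussian :: (real ^ 2) measure)"
proof
  have "(\<integral>\<^sup>+v. 1 \<partial>(std_gaussian :: (real ^ 2) measure)) = 1"
    using std_gaussian_transform[of 0 0 0] by simp
  then show "emeasure std_gaussian (space (std_gaussian :: (real ^ 2) measure)) = 1"
    by simp
qed

text \<open>
  The trace is half the sum of the quadratic forms of \<open>B\<close> at the independent Gaussian vectors, so the
  transform is a product.
\<close>

lemma wishart_transform:
  fixes B :: "real ^ 2 ^ 2"
  assumes sym: "B $ 1 $ 2 = B $ 2 $ 1"
    and pos: "0 < 1 + B $ 1 $ 1" "0 < Determinants.det (Finite_Cartesian_Product.mat 1 + B)"
  shows "(\<integral>z. exp (- trace (B ** z)) \<partial>wishart n (1 / 2)) = (1 / sqrt (Determinants.det (Finite_Cartesian_Product.mat 1 + B))) ^ n"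
proof -
  let ?G = "std_gaussian :: (real ^ 2) measure"
  interpret G: prob_space ?G by (rule prob_space_std_gaussian)
  interpret product_sigma_finite "\<lambda>_::nat. ?G"
    by unfold_locales
  let ?e = "\<lambda>v::real ^ 2. exp (- (B $ 1 $ 1 * (v $ 1)\<^sup>2 + 2 * B $ 1 $ 2 * v $ 1 * v $ 2 + B $ 2 $ 2 * (v $ 2)\<^sup>2) / 2)"
  have det: "Determinants.det (Finite_Cartesian_Product.mat 1 + B) = (1 + B $ 1 $ 1) * (1 + B $ 2 $ 2) - (B $ 1 $ 2)\<^sup>2"
    by (simp add: det_2 sym Finite_Cartesian_Product.mat_def power2_eq_square)
  have sets_G: "sets ?G = sets borel" by (simp add: std_gaussian_def)
  have outer_meas [measurable]: "(\<lambda>v. outer v v) \<in> borel_measurable ?G"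
    unfolding measurable_cong_sets[OF sets_G refl] outer_def
    by (intro borel_measurable_continuous_onI continuous_intros)
  have map_meas [measurable]: "(\<lambda>g. (1 / 2) *\<^sub>R (\<Sum>k<n. outer (g k) (g k))) \<in> borel_measurable (Pi\<^sub>M {..<n} (\<lambda>_. ?G))"
    by measurable
  have tr_meas [measurable]: "(\<lambda>z. trace (B ** z)) \<in> borel_measurable borel"
    unfolding trace_def matrix_matrix_mult_def
    by (intro borel_measurable_continuous_onI continuous_intros)
  have split: "exp (- trace (B ** ((1 / 2) *\<^sub>R (\<Sum>k<n. outer (g k) (g k))))) = (\<Prod>k<n. ?e (g k))" for g
  proof -
    have entry: "((1 / 2) *\<^sub>R (\<Sum>k<n. outer (g k) (g k))) $ i $ j = (\<Sum>k<n. g k $ i * g k $ j / 2)" for i j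
      by (simp add: outer_def sum_divide_distrib)
    have tr: "trace (B ** z) = B $ 1 $ 1 * z $ 1 $ 1 + B $ 1 $ 2 * z $ 2 $ 1
        + (B $ 2 $ 1 * z $ 1 $ 2 + B $ 2 $ 2 * z $ 2 $ 2)" for z
      by (simp add: trace_def matrix_matrix_mult_def UNIV_2)
    have "trace (B ** ((1 / 2) *\<^sub>R (\<Sum>k<n. outer (g k) (g k))))
        = (\<Sum>k<n. (B $ 1 $ 1 * (g k $ 1)\<^sup>2 + 2 * B $ 1 $ 2 * g k $ 1 * g k $ 2 + B $ 2 $ 2 * (g k $ 2)\<^sup>2) / 2)"
      unfolding tr entry sum_distrib_left sum.distrib[symmetric]
      by (intro sum.cong refl) (simp add: sym power2_eq_square field_simps)
    then show ?thesis
      by (simp only: sum_negf[symmetric] exp_sum[OF finite_lessThan] minus_divide_left)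
  qed
  have "(\<integral>\<^sup>+z. ennreal (exp (- trace (B ** z))) \<partial>wishart n (1 / 2))
      = (\<integral>\<^sup>+g. (\<Prod>k<n. ennreal (?e (g k))) \<partial>Pi\<^sub>M {..<n} (\<lambda>_. ?G))"
    unfolding wishart_def by (subst nn_integral_distr) (simp_all add: split prod_ennreal)
  also have "\<dots> = (\<Prod>k<n. \<integral>\<^sup>+v. ennreal (?e v) \<partial>?G)"
    by (rule product_nn_integral_prod) (auto simp: measurable_cong_sets[OF sets_G refl])
  also have "\<dots> = ennreal ((1 / sqrt (Determinants.det (Finite_Cartesian_Product.mat 1 + B))) ^ n)"
    using pos std_gaussian_transform[of "B $ 1 $ 1" "B $ 2 $ 2" "B $ 1 $ 2"]
    unfolding det by (simp only: prod_constant card_lessThan) (simp add: ennreal_power)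
  finally have nn: "(\<integral>\<^sup>+z. ennreal (exp (- trace (B ** z))) \<partial>wishart n (1 / 2))
      = ennreal ((1 / sqrt (Determinants.det (Finite_Cartesian_Product.mat 1 + B))) ^ n)" .
  have "measurable (wishart n (1 / 2)) borel = (borel_measurable borel :: (real ^ 2 ^ 2 \<Rightarrow> real) set)"
    by (intro measurable_cong_sets) (simp_all add: wishart_def)
  then have "(\<lambda>z. exp (- trace (B ** z))) \<in> borel_measurable (wishart n (1 / 2))"
    by simp
  then have "(\<integral>z. exp (- trace (B ** z)) \<partial>wishart n (1 / 2))
      = enn2real (ennreal ((1 / sqrt (Determinants.det (Finite_Cartesian_Product.mat 1 + B))) ^ n))"
    unfolding nn[symmetric] by (rule integral_eq_nn_integral) (rule AE_I2, rule exp_ge_zero)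
  moreover have "0 \<le> (1 / sqrt (Determinants.det (Finite_Cartesian_Product.mat 1 + B))) ^ n"
    using pos(2) by (intro zero_le_power divide_nonneg_nonneg real_sqrt_ge_zero less_imp_le) auto
  ultimately show ?thesis by (simp only: enn2real_ennreal)
qed

section \<open>The round cone of the three traces\<close>

text \<open>
  The vector \<open>s\<close> with \<open>B(s) = s\<^sub>1 H\<^sub>1 + s\<^sub>2 H\<^sub>2 + s\<^sub>3 H\<^sub>3 = v v\<^sup>T\<close> for \<open>v = (1, x)\<close>.
\<close>

definition rank_one_direction :: "real \<Rightarrow> real ^ 3" where
  "rank_one_direction x = vector [3 / 2 * x\<^sup>2 - 2 * x - 1 / 2, x, (1 - x\<^sup>2) / 2]"

text \<open>
  The determinant of \<open>I + B(s)\<close>.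
\<close>

definition wishart_denominator :: "real ^ 3 \<Rightarrow> real" where
  "wishart_denominator s =
    (1 + (s $ 1 + 2 * s $ 2 + 3 * s $ 3)) * (1 + (s $ 1 + 2 * s $ 2 + s $ 3)) - (s $ 2)\<^sup>2"

lemma wishart_denominator_rank_one:
  "wishart_denominator (r *\<^sub>R rank_one_direction x) = 1 + r * (1 + x\<^sup>2)"
  by (simp add: wishart_denominator_def rank_one_direction_def power2_eq_square field_simps)

text \<open>
  Because \<open>H\<^sub>1\<close> is the identity, the shift cancels the summand \<open>I\<close>, and \<open>r v v\<^sup>T\<close> is singular.
\<close>

lemma wishart_denominator_shifted_rank_one:
  "wishart_denominator (r *\<^sub>R rank_one_direction x - axis 1 1) = 0"
  by (simp add: wishart_denominator_def rank_one_direction_def axis_def power2_eq_square field_simps)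

lemma wishart_denominator_polynomial: "\<exists>p. \<forall>u. wishart_denominator (a + u *\<^sub>R b) = poly p u"
proof
  let ?l = "\<lambda>c0 c1 c2 c3. [:c0 + c1 * a $ 1 + c2 * a $ 2 + c3 * a $ 3, c1 * b $ 1 + c2 * b $ 2 + c3 * b $ 3:]"
  show "\<forall>u. wishart_denominator (a + u *\<^sub>R b)
      = poly (?l 1 1 2 3 * ?l 1 1 2 1 - (?l 0 0 1 0)\<^sup>2) u"
    by (simp add: wishart_denominator_def power2_eq_square algebra_simps)
qed

lemma inner_rank_one:
  "k \<bullet> rank_one_direction x = poly [:(k $ 3 - k $ 1) / 2, k $ 2 - 2 * k $ 1, (3 * k $ 1 - k $ 3) / 2:] x"
  by (simp add: rank_one_direction_def inner_vec_def sum_3 power2_eq_square field_simps)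

text \<open>
  A linear functional that vanishes at \<open>v v\<^sup>T\<close> for three directions \<open>v\<close> vanishes on all symmetric matrices.
\<close>

lemma inner_rank_one_zeros_finite:
  assumes "k \<noteq> 0"
  shows "finite {x. k \<bullet> rank_one_direction x = 0}"
proof -
  have "[:(k $ 3 - k $ 1) / 2, k $ 2 - 2 * k $ 1, (3 * k $ 1 - k $ 3) / 2:] \<noteq> 0"
  proof
    assume "[:(k $ 3 - k $ 1) / 2, k $ 2 - 2 * k $ 1, (3 * k $ 1 - k $ 3) / 2:] = 0"
    then have "k $ 1 = 0" "k $ 2 = 0" "k $ 3 = 0" by auto
    then have "k = 0" by (simp add: Finite_Cartesian_Product.vec_eq_iff forall_3)
    with assms show False by simp
  qed
  then show ?thesis unfolding inner_rank_one by (rule poly_roots_finite)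
qed

text \<open>
  For an \<open>x\<close> outside the finitely many exceptional values, all nonzero \<open>k\<close> are positive at the rank one
  direction, which leaves room for a shift after scaling.
\<close>

lemma polyhedral_cone_beyond_rank_one:
  assumes fin: "finite \<K>" and nonneg: "\<And>k x. k \<in> \<K> \<Longrightarrow> 0 \<le> k \<bullet> rank_one_direction x"
  obtains r x where "\<And>k. k \<in> \<K> \<Longrightarrow> 0 \<le> k \<bullet> (r *\<^sub>R rank_one_direction x - axis 1 1)"
proof -
  have "finite (\<Union>k\<in>\<K> - {0}. {x. k \<bullet> rank_one_direction x = 0})"
    using fin inner_rank_one_zeros_finite by auto
  then obtain x where x: "x \<notin> (\<Union>k\<in>\<K> - {0}. {x. k \<bullet> rank_one_direction x = 0})"
    using ex_new_if_finite[OF infinite_UNIV_char_0] by blast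
  have pos: "0 < k \<bullet> rank_one_direction x" if "k \<in> \<K>" "k \<noteq> 0" for k
    using nonneg[OF that(1), of x] x that by (force simp: less_le)
  \<comment> \<open>The sum dominates each of its terms, so \<open>r (k \<bullet> c) \<ge> |k $ 1|\<close> for every nonzero \<open>k\<close>, where \<open>c\<close> is the rank one direction.\<close>
  define r where "r = (\<Sum>k\<in>\<K>. \<bar>k $ 1\<bar> / (k \<bullet> rank_one_direction x))"
  show thesis
  proof (rule that[of r x])
    fix k assume k: "k \<in> \<K>"
    show "0 \<le> k \<bullet> (r *\<^sub>R rank_one_direction x - axis 1 1)"
    proof (cases "k = 0")
      case False
      have "\<bar>k $ 1\<bar> / (k \<bullet> rank_one_direction x) \<le> r"
        unfolding r_def using k fin nonneg by (intro member_le_sum) auto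
      then have "\<bar>k $ 1\<bar> \<le> r * (k \<bullet> rank_one_direction x)"
        using pos[OF k False] by (simp add: pos_divide_le_eq)
      then show ?thesis by (simp add: inner_diff_right inner_axis)
    qed simp
  qed
qed

text \<open>
  For \<open>s \<ge> 0\<close> the matrix \<open>B(s)\<close> is a nonnegative combination of positive definite matrices, so
  \<open>det (I + B(s)) > 0\<close>.
\<close>

lemma wishart_traces_transform:
  fixes s :: "real ^ 3" and Z :: "'w \<Rightarrow> real ^ 2 ^ 2" and X :: "'w \<Rightarrow> real ^ 3" and H1 H2 H3 :: "real ^ 2 ^ 2"
  assumes s: "\<And>j. 0 \<le> s $ j"
    and Z: "Z \<in> borel_measurable M" "distr M borel Z = wishart 2 (1 / 2)"
    and H: "H1 = vector [vector [1, 0], vector [0, 1]]"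
      "H2 = vector [vector [2, 1], vector [1, 2]]" "H3 = vector [vector [3, 0], vector [0, 1]]"
    and X: "\<And>\<omega>. X \<omega> = vector [trace (H1 ** Z \<omega>), trace (H2 ** Z \<omega>), trace (H3 ** Z \<omega>)]"
  shows "(\<integral>\<omega>. exp (- (s \<bullet> X \<omega>)) \<partial>M) * wishart_denominator s = 1"
proof -
  define B :: "real ^ 2 ^ 2" where "B = s $ 1 *\<^sub>R H1 + s $ 2 *\<^sub>R H2 + s $ 3 *\<^sub>R H3"
  have B: "B $ 1 $ 1 = s $ 1 + 2 * s $ 2 + 3 * s $ 3" "B $ 1 $ 2 = s $ 2" "B $ 2 $ 1 = s $ 2"
    "B $ 2 $ 2 = s $ 1 + 2 * s $ 2 + s $ 3"
    by (simp_all add: B_def H)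
  have det: "Determinants.det (Finite_Cartesian_Product.mat 1 + B) = wishart_denominator s"
    by (simp add: det_2 Finite_Cartesian_Product.mat_def B wishart_denominator_def power2_eq_square)
  have pos: "0 < wishart_denominator s"
  proof -
    have "0 \<le> s $ 1" "0 \<le> s $ 2" "0 \<le> s $ 3" using s by auto
    then have "s $ 2 * s $ 2 < (1 + (s $ 1 + 2 * s $ 2 + 3 * s $ 3)) * (1 + (s $ 1 + 2 * s $ 2 + s $ 3))"
      by (intro mult_strict_mono) auto
    then show ?thesis by (simp add: wishart_denominator_def power2_eq_square)
  qed
  have inner: "s \<bullet> X \<omega> = trace (B ** Z \<omega>)" for \<omega>
    by (simp add: X inner_vec_def sum_3 B_def H trace_def matrix_matrix_mult_def UNIV_2 algebra_simps)
  have meas: "(\<lambda>z. exp (- trace (B ** z))) \<in> borel_measurable borel"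
    unfolding trace_def matrix_matrix_mult_def
    by (intro borel_measurable_continuous_onI continuous_intros)
  have "(\<integral>\<omega>. exp (- (s \<bullet> X \<omega>)) \<partial>M) = (\<integral>z. exp (- trace (B ** z)) \<partial>wishart 2 (1 / 2))"
    unfolding inner Z(2)[symmetric] by (rule integral_distr[symmetric, OF Z(1) meas])
  also have "\<dots> = (1 / sqrt (wishart_denominator s)) ^ 2"
    using wishart_transform[of B 2] s[of 1] s[of 2] s[of 3] pos
    by (simp add: det) (simp add: B)
  also have "\<dots> = 1 / wishart_denominator s" using pos by (simp add: power_divide)
  finally show ?thesis using pos by simp
qed

theorem theorem4p5:
  fixes M :: "'w measure"
    and Z :: "'w \<Rightarrow> real ^ 2 ^ 2"
    and X :: "'w \<Rightarrow> real ^ 3"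
    and H1 H2 H3 :: "real ^ 2 ^ 2"
  assumes "prob_space M"
    and "Z \<in> borel_measurable M"
    and "distr M borel Z = wishart 2 (1 / 2)"
    and "H1 = vector [vector [1, 0], vector [0, 1]]"
    and "H2 = vector [vector [2, 1], vector [1, 2]]"
    and "H3 = vector [vector [3, 0], vector [0, 1]]"
    and "\<And>\<omega>. X \<omega> = vector [trace (H1 ** Z \<omega>), trace (H2 ** Z \<omega>), trace (H3 ** Z \<omega>)]"
  shows "X \<notin> mph_star M"
proof
  assume "X \<in> mph_star M"
  then obtain \<K> where \<K>: "finite \<K>"
    and ray: "\<And>k c. k \<in> \<K> \<Longrightarrow> (\<And>r. 0 \<le> r \<Longrightarrow> 1 \<le> wishart_denominator (r *\<^sub>R c)) \<Longrightarrow> 0 \<le> k \<bullet> c"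
    and nonzero: "\<And>s. (\<And>k. k \<in> \<K> \<Longrightarrow> 0 \<le> k \<bullet> s) \<Longrightarrow> wishart_denominator s \<noteq> 0"
    using mph_star_reward_cone[OF _ wishart_traces_transform[OF _ assms(2-7)]
      wishart_denominator_polynomial] by metis
  have "0 \<le> k \<bullet> rank_one_direction x" if "k \<in> \<K>" for k x
    by (rule ray[OF that]) (simp add: wishart_denominator_rank_one)
  then obtain r x where "\<And>k. k \<in> \<K> \<Longrightarrow> 0 \<le> k \<bullet> (r *\<^sub>R rank_one_direction x - axis 1 1)"
    using polyhedral_cone_beyond_rank_one[OF \<K>] by metis
  from nonzero[OF this] show False
    by (simp add: wishart_denominator_shifted_rank_one)
qed

end
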